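(* Let $n\geq 2$, $1\leq p\leq\infty$, $0<s<1$ with $sp\geq n$, and $1\leq q\leq r<\infty$. Let $K,V:\mathbf{R}^n\to\mathbf{R}$ be two positive Lebesgue measurable functions such that for some $t\in(1,\infty]$ one has $K\in L^t(\Omega)$ for each measurable set $\Omega\subset\mathbf{R}^n$ with $\mathfrak{L}(\Omega)<\infty$, such that $\inf_{\mathbf{R}^n}V\geq V_0>0$ for some constant $V_0$, and such that $KV^{-\tau}$ vanishes at infinity for some $\tau\in(0,1)$ if $q<r$, or for $\tau=1$ if $q=r$. Then the embedding $M^{s;q,p}_{\mathrm V}(\mathbf{R}^n)\to L^r_{\mathrm K}(\mathbf{R}^n)$ is compact.
   Context: $\mathfrak{L}$ denotes Lebesgue measure on $\mathbf{R}^n$. A function $f\in L^1_{loc}(\mathbf{R}^n)$ is said to vanish at infinity if $\mathfrak{L}(\{x\in\mathbf{R}^n:|f(x)|\geq c\})<\infty$ for every constant $c>0$. When $sp\geq n$ (and $V\geq V_0>0$), $M^{s;q,p}_{\mathrm V}(\mathbf{R}^n)$ is the Banach space obtained as the completion of (the functions of finite norm in) $C^1_c(\mathbf{R}^n)$ with respect to the norm $$\|u\|_{M^{s;q,p}_{\mathrm V}(\mathbf{R}^n)}:=\Bigl(\int_{\mathbf{R}^n}|u|^qV\,dx\Bigr)^{1/q}+[u]_{s,p,\mathbf{R}^n},$$ where $[u]^p_{s,p,\mathbf{R}^n}:=\int_{\mathbf{R}^n}\int_{\mathbf{R}^n}\frac{|u(x)-u(y)|^p}{|x-y|^{n+sp}}\,dx\,dy$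 for $p<\infty$ and $[u]_{s,\infty,\mathbf{R}^n}:=\sup_{x\neq y}\frac{|u(x)-u(y)|}{|x-y|^s}$; it is a subspace of $M^{s;q,p}(\mathbf{R}^n)$, which is the same completion with $V\equiv 1$. $L^r_{\mathrm K}(\mathbf{R}^n)$ is the weighted Lebesgue space with norm $\bigl(\int_{\mathbf{R}^n}|u|^rK\,dx\bigr)^{1/r}$. *)

theory Defs
  imports "HOL-Analysis.Analysis"
begin

text \<open>
  Integrals are Lebesgue integrals of nonnegative functions with values in \<^typ>\<open>ennreal\<close>, so
  ``finite norm'' always means ``norm different from \<^term>\<open>\<infinity> :: ennreal\<close>''.  Elements of function
  spaces are represented by functions; two representatives are identified iff their difference
  has norm \<open>0\<close>.
\<close>

definition ennpowr :: "ennreal \<Rightarrow> real \<Rightarrow> ennreal" where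
  "ennpowr x a = (if x = \<infinity> then \<infinity> else ennreal (enn2real x powr a))"

definition Lp_on :: "ennreal \<Rightarrow> (real ^ 'n) set \<Rightarrow> (real ^ 'n \<Rightarrow> real) \<Rightarrow> bool" where
  "Lp_on t \<Omega> f \<longleftrightarrow> set_borel_measurable lebesgue \<Omega> f \<and>
     (if t = \<infinity> then \<exists>C. AE x\<in>\<Omega> in lebesgue. \<bar>f x\<bar> \<le> C
      else (\<integral>\<^sup>+x\<in>\<Omega>. ennreal (\<bar>f x\<bar> powr enn2real t) \<partial>lebesgue) < \<infinity>)"

definition vanishes_at_infinity :: "(real ^ 'n \<Rightarrow> real) \<Rightarrow> bool" where
  "vanishes_at_infinity f \<longleftrightarrow>
     (\<forall>C. compact C \<longrightarrow> f absolutely_integrable_on C) \<and>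
     (\<forall>c>0. emeasure lebesgue {x. \<bar>f x\<bar> \<ge> c} < \<infinity>)"

definition weighted_integral :: "real \<Rightarrow> (real ^ 'n \<Rightarrow> real) \<Rightarrow> (real ^ 'n \<Rightarrow> real) \<Rightarrow> ennreal" where
  "weighted_integral q W u = (\<integral>\<^sup>+x. ennreal (\<bar>u x\<bar> powr q * W x) \<partial>lebesgue)"

definition weighted_norm :: "real \<Rightarrow> (real ^ 'n \<Rightarrow> real) \<Rightarrow> (real ^ 'n \<Rightarrow> real) \<Rightarrow> ennreal" where
  "weighted_norm q W u = ennpowr (weighted_integral q W u) (1 / q)"

definition weighted_Lebesgue :: "real \<Rightarrow> (real ^ 'n \<Rightarrow> real) \<Rightarrow> (real ^ 'n \<Rightarrow> real) set" where
  "weighted_Lebesgue r W = {u \<in> borel_measurable lebesgue. weighted_norm r W u < \<infinity>}"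

definition gagliardo_integral :: "real \<Rightarrow> real \<Rightarrow> (real ^ 'n \<Rightarrow> real) \<Rightarrow> ennreal" where
  "gagliardo_integral s p u =
     (\<integral>\<^sup>+x. \<integral>\<^sup>+y. ennreal (\<bar>u x - u y\<bar> powr p / norm (x - y) powr (real CARD('n) + s * p))
        \<partial>lebesgue \<partial>lebesgue)"

definition holder_seminorm :: "real \<Rightarrow> (real ^ 'n \<Rightarrow> real) \<Rightarrow> ennreal" where
  "holder_seminorm s u =
     (SUP (x, y) \<in> {(x, y). x \<noteq> y}. ennreal (\<bar>u x - u y\<bar> / norm (x - y) powr s))"

definition gagliardo_seminorm :: "real \<Rightarrow> ennreal \<Rightarrow> (real ^ 'n \<Rightarrow> real) \<Rightarrow> ennreal" where
  "gagliardo_seminorm s p u =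
     (if p = \<infinity> then holder_seminorm s u
      else ennpowr (gagliardo_integral s (enn2real p) u) (1 / enn2real p))"

definition M_norm :: "real \<Rightarrow> real \<Rightarrow> ennreal \<Rightarrow> (real ^ 'n \<Rightarrow> real) \<Rightarrow> (real ^ 'n \<Rightarrow> real) \<Rightarrow> ennreal" where
  "M_norm s q p V u = weighted_norm q V u + gagliardo_seminorm s p u"

definition C1c :: "(real ^ 'n \<Rightarrow> real) set" where
  "C1c = {\<phi>. compact (closure {x. \<phi> x \<noteq> 0}) \<and>
     (\<exists>\<phi>'. (\<forall>x. (\<phi> has_derivative blinfun_apply (\<phi>' x)) (at x)) \<and> continuous_on UNIV \<phi>')}"

text \<open>
  The completion of the functions of finite norm in \<^term>\<open>C1c\<close>, realized as a space of functions:
  all measurable functions that are limits in norm of such functions.  The space contains these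
  functions (\<open>C1c_subset_M_space\<close>), they are dense by definition, and it is complete (\<open>M_space_complete\<close>),
  so it is the completion.  For \<open>p = \<infinity>\<close> the seminorm is a genuine supremum, so
  every member is its own continuous representative.
\<close>

definition M_space ::
    "real \<Rightarrow> real \<Rightarrow> ennreal \<Rightarrow> (real ^ 'n \<Rightarrow> real) \<Rightarrow> (real ^ 'n \<Rightarrow> real) set" where
  "M_space s q p V = {u \<in> borel_measurable lebesgue.
     \<exists>\<phi>. (\<forall>k. \<phi> k \<in> C1c \<and> M_norm s q p V (\<phi> k) < \<infinity>) \<and>
         (\<lambda>k. M_norm s q p V (\<lambda>x. u x - \<phi> k x)) \<longlonglongrightarrow> 0}"

text \<open>
  The identity map from \<open>X\<close> to \<open>Y\<close> is well defined, bounded and injective on classes modulo norm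
  \<open>0\<close>, and maps bounded sequences to sequences with a subsequence converging in \<open>Y\<close>.
\<close>

definition compact_embedding ::
    "('a \<Rightarrow> real) set \<Rightarrow> (('a \<Rightarrow> real) \<Rightarrow> ennreal) \<Rightarrow> ('a \<Rightarrow> real) set \<Rightarrow> (('a \<Rightarrow> real) \<Rightarrow> ennreal) \<Rightarrow> bool" where
  "compact_embedding X NX Y NY \<longleftrightarrow>
     X \<subseteq> Y \<and>
     (\<exists>C::real. \<forall>u\<in>X. NY u \<le> ennreal C * NX u) \<and>
     (\<forall>u\<in>X. NY u = 0 \<longrightarrow> NX u = 0) \<and>
     (\<forall>u :: nat \<Rightarrow> 'a \<Rightarrow> real. (\<forall>k. u k \<in> X) \<and> (\<exists>B::real. \<forall>k. NX (u k) \<le> ennreal B) \<longrightarrow>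
        (\<exists>\<sigma>. strict_mono \<sigma> \<and> (\<exists>f\<in>Y. (\<lambda>k. NY (\<lambda>x. u (\<sigma> k) x - f x)) \<longlonglongrightarrow> 0)))"

lemma ennreal_mult_double:
  assumes "0 \<le> B" "0 \<le> x"
  shows "ennreal B * (ennreal x + ennreal x) = ennreal (2 * B * x)"
proof -
  have "ennreal x + ennreal x = ennreal (2 * x)"
    using assms by (subst ennreal_plus[symmetric]) auto
  then have "ennreal B * (ennreal x + ennreal x) = ennreal (B * (2 * x))"
    using assms by (simp only: ennreal_mult)
  then show ?thesis
    by (simp only: mult_ac)
qed

lemma powr_add_le:
  fixes a b p :: real
  assumes "0 \<le> p"
  shows "\<bar>a + b\<bar> powr p \<le> 2 powr p * (\<bar>a\<bar> powr p + \<bar>b\<bar> powr p)"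
proof -
  have "\<bar>a + b\<bar> powr p \<le> (2 * max \<bar>a\<bar> \<bar>b\<bar>) powr p"
    using assms by (intro powr_mono2) auto
  also have "\<dots> = 2 powr p * max \<bar>a\<bar> \<bar>b\<bar> powr p"
    by (simp add: powr_mult)
  also have "\<dots> \<le> 2 powr p * (\<bar>a\<bar> powr p + \<bar>b\<bar> powr p)"
    by (intro mult_left_mono) (auto simp: max_def)
  finally show ?thesis .
qed

lemma ennpowr_le:
  assumes "0 < a" "0 < e" "x \<le> ennreal (e powr (1 / a))"
  shows "ennpowr x a \<le> ennreal e"
proof -
  obtain y where y: "x = ennreal y" "0 \<le> y"
    using assms(3) by (cases x) (auto simp: top_unique)
  then have "y \<le> e powr (1 / a)"
    using assms by simp
  then have "y powr a \<le> (e powr (1 / a)) powr a"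
    using assms y by (intro powr_mono2) auto
  then show ?thesis
    using y assms by (auto simp: ennpowr_def powr_powr intro!: ennreal_leI)
qed

lemma le_ennpowr:
  assumes "0 < a" "0 < e" "ennpowr x a \<le> ennreal (e powr a)"
  shows "x \<le> ennreal e"
proof -
  obtain y where y: "x = ennreal y" "0 \<le> y"
    using assms(3) by (cases x) (auto simp: ennpowr_def top_unique)
  then have "y powr a \<le> e powr a"
    using assms by (simp add: ennpowr_def)
  then have "y \<le> e"
    using assms(1,2) y(2) powr_less_mono2[of a e y] by (meson less_eq_real_def not_le)
  then show ?thesis
    using y by (auto intro!: ennreal_leI)
qed

lemma weighted_integral_add:
  fixes u w W :: "real ^ 'n \<Rightarrow> real"
  assumes [measurable]: "u \<in> borel_measurable lebesgue" "w \<in> borel_measurable lebesgue"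
      "W \<in> borel_measurable lebesgue"
    and W: "\<And>x. 0 < W x" and q: "0 < q"
  shows "weighted_integral q W (\<lambda>x. u x + w x)
    \<le> ennreal (2 powr q) * (weighted_integral q W u + weighted_integral q W w)"
proof -
  have le: "ennreal (\<bar>u x + w x\<bar> powr q * W x)
    \<le> ennreal (2 powr q) * (ennreal (\<bar>u x\<bar> powr q * W x) + ennreal (\<bar>w x\<bar> powr q * W x))" for x
  proof -
    have "\<bar>u x + w x\<bar> powr q * W x \<le> 2 powr q * (\<bar>u x\<bar> powr q + \<bar>w x\<bar> powr q) * W x"
      using W[of x] q by (intro mult_right_mono powr_add_le) auto
    also have "\<dots> = 2 powr q * (\<bar>u x\<bar> powr q * W x + \<bar>w x\<bar> powr q * W x)"
      by (simp add: algebra_simps)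
    finally show ?thesis
      using W[of x] by (simp flip: ennreal_plus ennreal_mult add: ennreal_leI less_imp_le)
  qed
  have "weighted_integral q W (\<lambda>x. u x + w x)
    \<le> (\<integral>\<^sup>+x. ennreal (2 powr q) * (ennreal (\<bar>u x\<bar> powr q * W x) + ennreal (\<bar>w x\<bar> powr q * W x)) \<partial>lebesgue)"
    unfolding weighted_integral_def by (intro nn_integral_mono le)
  also have "\<dots> = ennreal (2 powr q) * (weighted_integral q W u + weighted_integral q W w)"
    unfolding weighted_integral_def by (simp add: nn_integral_cmult nn_integral_add)
  finally show ?thesis .
qed

lemma holder_seminorm_le_iff:
  fixes u :: "real ^ 'n \<Rightarrow> real"
  assumes "0 \<le> e"
  shows "holder_seminorm s u \<le> ennreal e \<longleftrightarrow> (\<forall>x y. \<bar>u x - u y\<bar> \<le> e * norm (x - y) powr s)"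
proof -
  have "ennreal (\<bar>u x - u y\<bar> / norm (x - y) powr s) \<le> ennreal e
      \<longleftrightarrow> \<bar>u x - u y\<bar> \<le> e * norm (x - y) powr s" if "x \<noteq> y" for x y
    using that assms by (subst ennreal_le_iff) (auto simp: pos_divide_le_eq)
  then have "holder_seminorm s u \<le> ennreal e \<longleftrightarrow>
      (\<forall>x y. x \<noteq> y \<longrightarrow> \<bar>u x - u y\<bar> \<le> e * norm (x - y) powr s)"
    unfolding holder_seminorm_def by (auto simp: SUP_le_iff)
  also have "\<dots> \<longleftrightarrow> (\<forall>x y. \<bar>u x - u y\<bar> \<le> e * norm (x - y) powr s)"
    by auto (metis abs_zero cancel_comm_monoid_add_class.diff_cancel mult_zero_right norm_zero order_refl powr_zero_eq_one powr_0)
  finally show ?thesis .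
qed

lemma gagliardo_integral_lborel:
  "gagliardo_integral s p (u :: real ^ 'n \<Rightarrow> real) =
     (\<integral>\<^sup>+x. \<integral>\<^sup>+y. ennreal (\<bar>u x - u y\<bar> powr p / norm (x - y) powr (real CARD('n) + s * p))
        \<partial>lborel \<partial>lborel)"
  unfolding gagliardo_integral_def by (simp add: nn_integral_completion)

lemma gagliardo_integral_cong_AE:
  fixes u w :: "real ^ 'n \<Rightarrow> real"
  assumes "AE x in lborel. u x = w x"
  shows "gagliardo_integral s p u = gagliardo_integral s p w"
  unfolding gagliardo_integral_lborel
proof (rule nn_integral_cong_AE)
  show "AE x in lborel.
     (\<integral>\<^sup>+y. ennreal (\<bar>u x - u y\<bar> powr p / norm (x - y) powr (real CARD('n) + s * p)) \<partial>lborel) =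
     (\<integral>\<^sup>+y. ennreal (\<bar>w x - w y\<bar> powr p / norm (x - y) powr (real CARD('n) + s * p)) \<partial>lborel)"
    using assms
  proof eventually_elim
    case (elim x)
    show ?case
      by (rule nn_integral_cong_AE) (use assms in eventually_elim, simp add: elim)
  qed
qed

lemma gagliardo_integral_add:
  fixes u w :: "real ^ 'n \<Rightarrow> real"
  assumes "u \<in> borel_measurable lebesgue" "w \<in> borel_measurable lebesgue" and p: "0 < p"
  shows "gagliardo_integral s p (\<lambda>x. u x + w x)
    \<le> ennreal (2 powr p) * (gagliardo_integral s p u + gagliardo_integral s p w)"
proof -
  obtain f where f[measurable]: "f \<in> borel_measurable lborel" and uf: "AE x in lborel. u x = f x"
    using completion_ex_borel_measurable_real[OF assms(1)] by blast
  obtain g where g[measurable]: "g \<in> borel_measurable lborel" and wg: "AE x in lborel. w x = g x"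
    using completion_ex_borel_measurable_real[OF assms(2)] by blast
  define b where "b = real CARD('n) + s * p"
  define F where "F h x y = ennreal (\<bar>h x - h y\<bar> powr p / norm (x - y) powr b)"
    for h :: "real ^ 'n \<Rightarrow> real" and x y
  have [measurable]: "(\<lambda>(x, y). F h x y) \<in> borel_measurable (lborel \<Otimes>\<^sub>M lborel)"
    if [measurable]: "h \<in> borel_measurable lborel" for h
    unfolding F_def by measurable
  have le: "F (\<lambda>x. f x + g x) x y \<le> ennreal (2 powr p) * (F f x y + F g x y)" for x y
  proof -
    have "\<bar>f x + g x - (f y + g y)\<bar> powr p = \<bar>(f x - f y) + (g x - g y)\<bar> powr p"
      by (simp add: algebra_simps)
    also have "\<dots> \<le> 2 powr p * (\<bar>f x - f y\<bar> powr p + \<bar>g x - g y\<bar> powr p)"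
      using p by (intro powr_add_le) auto
    finally have "\<bar>f x + g x - (f y + g y)\<bar> powr p / norm (x - y) powr b
        \<le> 2 powr p * (\<bar>f x - f y\<bar> powr p + \<bar>g x - g y\<bar> powr p) / norm (x - y) powr b"
      by (intro divide_right_mono) auto
    also have "\<dots> = 2 powr p * (\<bar>f x - f y\<bar> powr p / norm (x - y) powr b
        + \<bar>g x - g y\<bar> powr p / norm (x - y) powr b)"
      by (metis add_divide_distrib times_divide_eq_right)
    finally show ?thesis
      unfolding F_def by (simp flip: ennreal_plus ennreal_mult add: ennreal_leI)
  qed
  have "AE x in lborel. u x + w x = f x + g x"
    using uf wg by eventually_elim simp
  then have "gagliardo_integral s p (\<lambda>x. u x + w x) = gagliardo_integral s p (\<lambda>x. f x + g x)"
    by (rule gagliardo_integral_cong_AE)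
  also have "\<dots> = (\<integral>\<^sup>+x. \<integral>\<^sup>+y. F (\<lambda>x. f x + g x) x y \<partial>lborel \<partial>lborel)"
    by (simp add: gagliardo_integral_lborel F_def b_def)
  also have "\<dots> \<le> (\<integral>\<^sup>+x. \<integral>\<^sup>+y. ennreal (2 powr p) * (F f x y + F g x y) \<partial>lborel \<partial>lborel)"
    by (intro nn_integral_mono le)
  also have "\<dots> = ennreal (2 powr p) *
      ((\<integral>\<^sup>+x. \<integral>\<^sup>+y. F f x y \<partial>lborel \<partial>lborel) + (\<integral>\<^sup>+x. \<integral>\<^sup>+y. F g x y \<partial>lborel \<partial>lborel))"
    by (simp add: nn_integral_cmult nn_integral_add)
  also have "\<dots> = ennreal (2 powr p) * (gagliardo_integral s p f + gagliardo_integral s p g)"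
    by (simp add: gagliardo_integral_lborel F_def b_def)
  finally show ?thesis
    using gagliardo_integral_cong_AE[OF uf] gagliardo_integral_cong_AE[OF wg] by simp
qed

lemma weighted_integral_Fatou:
  fixes w W :: "real ^ 'n \<Rightarrow> real" and f :: "nat \<Rightarrow> real ^ 'n \<Rightarrow> real"
  assumes [measurable]: "\<And>k. f k \<in> borel_measurable lebesgue" "W \<in> borel_measurable lebesgue"
    and lim: "AE x in lebesgue. (\<lambda>k. f k x) \<longlonglongrightarrow> w x" and q: "0 < q"
  shows "weighted_integral q W w \<le> liminf (\<lambda>k. weighted_integral q W (f k))"
proof -
  have "weighted_integral q W w
      = (\<integral>\<^sup>+x. liminf (\<lambda>k. ennreal (\<bar>f k x\<bar> powr q * W x)) \<partial>lebesgue)"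
    unfolding weighted_integral_def
  proof (rule nn_integral_cong_AE)
    show "AE x in lebesgue. ennreal (\<bar>w x\<bar> powr q * W x)
        = liminf (\<lambda>k. ennreal (\<bar>f k x\<bar> powr q * W x))"
      using lim
    proof eventually_elim
      case (elim x)
      have "(\<lambda>k. ennreal (\<bar>f k x\<bar> powr q * W x)) \<longlonglongrightarrow> ennreal (\<bar>w x\<bar> powr q * W x)"
        using q by (intro tendsto_ennrealI tendsto_mult tendsto_powr' tendsto_rabs elim) auto
      then show ?case
        by (intro lim_imp_Liminf[symmetric]) auto
    qed
  qed
  also have "\<dots> \<le> liminf (\<lambda>k. weighted_integral q W (f k))"
    unfolding weighted_integral_def by (intro nn_integral_liminf) measurable
  finally show ?thesis .
qed

lemma gagliardo_integral_Fatou: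
  fixes w :: "real ^ 'n \<Rightarrow> real" and f :: "nat \<Rightarrow> real ^ 'n \<Rightarrow> real"
  assumes f: "\<And>k. f k \<in> borel_measurable lebesgue"
    and lim: "AE x in lebesgue. (\<lambda>k. f k x) \<longlonglongrightarrow> w x" and p: "0 < p"
  shows "gagliardo_integral s p w \<le> liminf (\<lambda>k. gagliardo_integral s p (f k))"
proof -
  have "\<forall>k. \<exists>g. g \<in> borel_measurable lborel \<and> (AE x in lborel. f k x = g x)"
    using completion_ex_borel_measurable_real[OF f] by blast
  then obtain g where g[measurable]: "\<And>k. g k \<in> borel_measurable lborel"
    and fg: "\<And>k. AE x in lborel. f k x = g k x"
    by metis
  have "AE x in lborel. (\<forall>k. f k x = g k x) \<and> (\<lambda>k. f k x) \<longlonglongrightarrow> w x"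
    using fg lim by (simp add: AE_all_countable AE_completion_iff)
  then obtain N where N[measurable]: "N \<in> sets lborel" "emeasure lborel N = 0"
    and sub: "{x \<in> space lborel. \<not> ((\<forall>k. f k x = g k x) \<and> (\<lambda>k. f k x) \<longlonglongrightarrow> w x)} \<subseteq> N"
    by (elim AE_E) blast
  have notN: "AE x in lborel. x \<notin> N"
    using N by (intro AE_not_in) auto
  define h where "h k x = (if x \<in> N then 0 else g k x)" for k x
  define h0 where "h0 x = (if x \<in> N then 0 else w x)" for x
  have hlim: "(\<lambda>k. h k x) \<longlonglongrightarrow> h0 x" for x
  proof (cases "x \<in> N")
    case False
    then have "(\<lambda>k. f k x) \<longlonglongrightarrow> w x" "f k x = g k x" for k
      using sub by auto
    with False show ?thesis
      by (simp add: h_def h0_def)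
  qed (simp add: h_def h0_def)
  have [measurable]: "h k \<in> borel_measurable lborel" for k
    unfolding h_def by measurable
  have [measurable]: "h0 \<in> borel_measurable lborel"
    by (rule borel_measurable_LIMSEQ_real[OF hlim]) measurable
  have fh: "AE x in lborel. f k x = h k x" for k
    using fg[of k] notN by eventually_elim (simp add: h_def)
  have wh: "AE x in lborel. w x = h0 x"
    using notN by eventually_elim (simp add: h0_def)
  define b where "b = real CARD('n) + s * p"
  define F where "F u x y = ennreal (\<bar>u x - u y\<bar> powr p / norm (x - y) powr b)"
    for u :: "real ^ 'n \<Rightarrow> real" and x y
  have [measurable]: "(\<lambda>(x, y). F u x y) \<in> borel_measurable (lborel \<Otimes>\<^sub>M lborel)"
    if [measurable]: "u \<in> borel_measurable lborel" for u
    unfolding F_def by measurable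
  have Flim: "F h0 x y = liminf (\<lambda>k. F (h k) x y)" for x y
  proof (cases "x = y")
    case True
    then show ?thesis
      by (simp add: F_def Liminf_const)
  next
    case False
    have "(\<lambda>k. F (h k) x y) \<longlonglongrightarrow> F h0 x y"
      unfolding F_def using p False
      by (intro tendsto_ennrealI tendsto_divide tendsto_powr' tendsto_rabs tendsto_diff hlim tendsto_const) auto
    then show ?thesis
      by (intro lim_imp_Liminf[symmetric]) auto
  qed
  have "gagliardo_integral s p w = (\<integral>\<^sup>+x. \<integral>\<^sup>+y. F h0 x y \<partial>lborel \<partial>lborel)"
    unfolding gagliardo_integral_cong_AE[OF wh] by (simp add: gagliardo_integral_lborel F_def b_def)
  also have "\<dots> = (\<integral>\<^sup>+x. \<integral>\<^sup>+y. liminf (\<lambda>k. F (h k) x y) \<partial>lborel \<partial>lborel)"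
    by (simp add: Flim)
  also have "\<dots> \<le> (\<integral>\<^sup>+x. liminf (\<lambda>k. \<integral>\<^sup>+y. F (h k) x y \<partial>lborel) \<partial>lborel)"
    by (intro nn_integral_mono nn_integral_liminf) measurable
  also have "\<dots> \<le> liminf (\<lambda>k. \<integral>\<^sup>+x. \<integral>\<^sup>+y. F (h k) x y \<partial>lborel \<partial>lborel)"
    by (intro nn_integral_liminf) measurable
  also have "\<dots> = liminf (\<lambda>k. gagliardo_integral s p (f k))"
    unfolding gagliardo_integral_cong_AE[OF fh] by (simp add: gagliardo_integral_lborel F_def b_def)
  finally show ?thesis .
qed

lemma M_norm_uminus: "M_norm s q p V (\<lambda>x. - u x) = M_norm s q p V u"
proof -
  have "\<bar>- u x - - u y\<bar> = \<bar>u x - u y\<bar>" for x y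
    by simp
  then show ?thesis
    by (simp only: M_norm_def weighted_norm_def weighted_integral_def gagliardo_seminorm_def
        gagliardo_integral_def holder_seminorm_def abs_minus_cancel)
qed

definition M_seminorm_integral :: "real \<Rightarrow> ennreal \<Rightarrow> (real ^ 'n \<Rightarrow> real) \<Rightarrow> ennreal" where
  "M_seminorm_integral s p u =
     (if p = \<infinity> then holder_seminorm s u else gagliardo_integral s (enn2real p) u)"

lemma enn2real_ge_1: "1 \<le> p \<Longrightarrow> p \<noteq> \<infinity> \<Longrightarrow> 1 \<le> enn2real p"
  by (cases p) auto

lemma M_norm_smallI:
  assumes "1 \<le> q" "1 \<le> p" "0 < e"
  obtains d where "0 < d" "\<And>u :: real ^ 'n \<Rightarrow> real. weighted_integral q V u \<le> ennreal d \<Longrightarrow>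
    M_seminorm_integral s p u \<le> ennreal d \<Longrightarrow> M_norm s q p V u \<le> ennreal e"
proof
  define P where "P = enn2real p"
  let ?a = "(e / 2) powr (1 / (1 / q))" and ?b = "if p = \<infinity> then e / 2 else (e / 2) powr (1 / (1 / P))"
  show "0 < min ?a ?b"
    using assms by auto
  fix u :: "real ^ 'n \<Rightarrow> real"
  assume *: "weighted_integral q V u \<le> ennreal (min ?a ?b)"
    "M_seminorm_integral s p u \<le> ennreal (min ?a ?b)"
  have "weighted_norm q V u \<le> ennreal (e / 2)"
    unfolding weighted_norm_def
    by (rule ennpowr_le) (use assms *(1) in \<open>auto intro: order_trans ennreal_leI\<close>)
  moreover have "M_seminorm_integral s p u \<le> ennreal ?b"
    using *(2) by (rule order_trans) (intro ennreal_leI, simp)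
  then have "gagliardo_seminorm s p u \<le> ennreal (e / 2)"
    unfolding gagliardo_seminorm_def M_seminorm_integral_def P_def
    using assms enn2real_ge_1[of p] by (auto intro!: ennpowr_le split: if_splits)
  ultimately have "M_norm s q p V u \<le> ennreal (e / 2) + ennreal (e / 2)"
    unfolding M_norm_def by (rule add_mono)
  also have "\<dots> = ennreal e"
    using assms by (simp flip: ennreal_plus)
  finally show "M_norm s q p V u \<le> ennreal e" .
qed

lemma M_norm_smallD:
  assumes "1 \<le> q" "1 \<le> p" "0 < e"
  obtains d where "0 < d" "\<And>u :: real ^ 'n \<Rightarrow> real. M_norm s q p V u \<le> ennreal d \<Longrightarrow>
    weighted_integral q V u \<le> ennreal e \<and> M_seminorm_integral s p u \<le> ennreal e"
proof
  define P where "P = enn2real p"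
  let ?a = "e powr (1 / q)" and ?b = "if p = \<infinity> then e else e powr (1 / P)"
  show "0 < min ?a ?b"
    using assms by auto
  fix u :: "real ^ 'n \<Rightarrow> real"
  assume *: "M_norm s q p V u \<le> ennreal (min ?a ?b)"
  have "weighted_norm q V u \<le> M_norm s q p V u" "gagliardo_seminorm s p u \<le> M_norm s q p V u"
    by (simp_all add: M_norm_def)
  moreover have "ennreal (min ?a ?b) \<le> ennreal ?a" "ennreal (min ?a ?b) \<le> ennreal ?b"
    by (auto intro!: ennreal_leI)
  ultimately have a: "weighted_norm q V u \<le> ennreal ?a" and b: "gagliardo_seminorm s p u \<le> ennreal ?b"
    using * order_trans by blast+
  have "weighted_integral q V u \<le> ennreal e"
    by (rule le_ennpowr[of "1 / q"]) (use a assms in \<open>auto simp: weighted_norm_def\<close>)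
  moreover have "M_seminorm_integral s p u \<le> ennreal e"
  proof (cases "p = \<infinity>")
    case True
    with b show ?thesis
      by (simp add: M_seminorm_integral_def gagliardo_seminorm_def)
  next
    case False
    with assms enn2real_ge_1[of p] have "1 \<le> P"
      by (auto simp: P_def)
    moreover have "ennpowr (gagliardo_integral s P u) (1 / P) \<le> ennreal (e powr (1 / P))"
      using b False by (simp add: gagliardo_seminorm_def P_def)
    ultimately have "gagliardo_integral s P u \<le> ennreal e"
      using assms(3) by (intro le_ennpowr[of "1 / P" e]) simp_all
    with False show ?thesis
      by (simp add: M_seminorm_integral_def P_def)
  qed
  ultimately show "weighted_integral q V u \<le> ennreal e \<and> M_seminorm_integral s p u \<le> ennreal e" ..
qed

lemma M_seminorm_integral_add:
  fixes u w :: "real ^ 'n \<Rightarrow> real"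
  assumes "u \<in> borel_measurable lebesgue" "w \<in> borel_measurable lebesgue" "1 \<le> p"
    "M_seminorm_integral s p u \<le> ennreal d" "M_seminorm_integral s p w \<le> ennreal d" "0 < d"
  shows "M_seminorm_integral s p (\<lambda>x. u x + w x) \<le> ennreal (2 * 2 powr (enn2real p) * d)"
proof (cases "p = \<infinity>")
  case True
  then have "holder_seminorm s u \<le> ennreal d" "holder_seminorm s w \<le> ennreal d"
    using assms by (auto simp: M_seminorm_integral_def)
  then have *: "\<bar>u x - u y\<bar> \<le> d * norm (x - y) powr s" "\<bar>w x - w y\<bar> \<le> d * norm (x - y) powr s" for x y
    using assms by (auto simp: holder_seminorm_le_iff)
  have "\<bar>u x + w x - (u y + w y)\<bar> \<le> (2 * d) * norm (x - y) powr s" for x y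
    using *[of x y] by (simp add: algebra_simps)
  then have "holder_seminorm s (\<lambda>x. u x + w x) \<le> ennreal (2 * d)"
    using assms by (subst holder_seminorm_le_iff) auto
  with True show ?thesis
    by (simp add: M_seminorm_integral_def)
next
  case False
  define P where "P = enn2real p"
  have "1 \<le> P"
    using False assms enn2real_ge_1[of p] by (auto simp: P_def)
  have "gagliardo_integral s P (\<lambda>x. u x + w x)
      \<le> ennreal (2 powr P) * (gagliardo_integral s P u + gagliardo_integral s P w)"
    using \<open>1 \<le> P\<close> assms by (intro gagliardo_integral_add) auto
  also have "\<dots> \<le> ennreal (2 powr P) * (ennreal d + ennreal d)"
    using False assms by (intro mult_left_mono add_mono) (auto simp: M_seminorm_integral_def P_def)
  also have "\<dots> = ennreal (2 * 2 powr P * d)"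
    using assms by (intro ennreal_mult_double) auto
  finally show ?thesis
    using False by (simp add: M_seminorm_integral_def P_def)
qed

lemma M_norm_add_small:
  fixes V :: "real ^ 'n \<Rightarrow> real"
  assumes q: "1 \<le> q" and p: "1 \<le> p" and e: "0 < e"
    and V: "V \<in> borel_measurable lebesgue" "\<And>x. 0 < V x"
  obtains d where "0 < d" "\<And>u w :: real ^ 'n \<Rightarrow> real. u \<in> borel_measurable lebesgue \<Longrightarrow>
    w \<in> borel_measurable lebesgue \<Longrightarrow> M_norm s q p V u \<le> ennreal d \<Longrightarrow>
    M_norm s q p V w \<le> ennreal d \<Longrightarrow> M_norm s q p V (\<lambda>x. u x + w x) \<le> ennreal e"
proof -
  obtain d1 where d1: "0 < d1" "\<And>u :: real ^ 'n \<Rightarrow> real. weighted_integral q V u \<le> ennreal d1 \<Longrightarrow>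
    M_seminorm_integral s p u \<le> ennreal d1 \<Longrightarrow> M_norm s q p V u \<le> ennreal e"
    using M_norm_smallI[OF q p e] by metis
  define A where "A = max (2 * 2 powr q) (2 * 2 powr (enn2real p))"
  have A: "0 < A" "2 * 2 powr q \<le> A" "2 * 2 powr (enn2real p) \<le> A"
    by (auto simp: A_def less_max_iff_disj)
  have d2: "0 < d1 / A"
    using A d1 by simp
  obtain d where d: "0 < d" "\<And>u :: real ^ 'n \<Rightarrow> real. M_norm s q p V u \<le> ennreal d \<Longrightarrow>
    weighted_integral q V u \<le> ennreal (d1 / A) \<and> M_seminorm_integral s p u \<le> ennreal (d1 / A)"
    using M_norm_smallD[OF q p d2] by metis
  show thesis
  proof (rule that[OF d(1)])
    fix u w :: "real ^ 'n \<Rightarrow> real"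
    assume uw: "u \<in> borel_measurable lebesgue" "w \<in> borel_measurable lebesgue"
      and "M_norm s q p V u \<le> ennreal d" "M_norm s q p V w \<le> ennreal d"
    then have *: "weighted_integral q V u \<le> ennreal (d1 / A)" "M_seminorm_integral s p u \<le> ennreal (d1 / A)"
      "weighted_integral q V w \<le> ennreal (d1 / A)" "M_seminorm_integral s p w \<le> ennreal (d1 / A)"
      using d by auto
    have le: "ennreal (B * (d1 / A)) \<le> ennreal d1" if "B \<le> A" for B
    proof (rule ennreal_leI)
      have "B * (d1 / A) \<le> A * (d1 / A)"
        using that d2 by (intro mult_right_mono) auto
      then show "B * (d1 / A) \<le> d1"
        using A by simp
    qed
    have "weighted_integral q V (\<lambda>x. u x + w x)
        \<le> ennreal (2 powr q) * (weighted_integral q V u + weighted_integral q V w)"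
      using q uw V by (intro weighted_integral_add) auto
    also have "\<dots> \<le> ennreal (2 powr q) * (ennreal (d1 / A) + ennreal (d1 / A))"
      using * by (intro mult_left_mono add_mono) auto
    also have "\<dots> = ennreal (2 * 2 powr q * (d1 / A))"
      using d2 by (intro ennreal_mult_double) auto
    also have "\<dots> \<le> ennreal d1"
      using A by (intro le) auto
    finally have 1: "weighted_integral q V (\<lambda>x. u x + w x) \<le> ennreal d1" .
    have "M_seminorm_integral s p (\<lambda>x. u x + w x) \<le> ennreal (2 * 2 powr (enn2real p) * (d1 / A))"
      using uw p * d2 by (intro M_seminorm_integral_add) auto
    also have "\<dots> \<le> ennreal d1"
      using A by (intro le) auto
    finally show "M_norm s q p V (\<lambda>x. u x + w x) \<le> ennreal e"
      using 1 by (intro d1) auto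
  qed
qed

lemma M_seminorm_integral_Fatou:
  fixes w :: "real ^ 'n \<Rightarrow> real" and f :: "nat \<Rightarrow> real ^ 'n \<Rightarrow> real"
  assumes f: "\<And>k. f k \<in> borel_measurable lebesgue" and p: "1 \<le> p" and d: "0 < d"
    and lim: "AE x in lebesgue. (\<lambda>k. f k x) \<longlonglongrightarrow> w x"
    and lim': "p = \<infinity> \<Longrightarrow> \<forall>x. (\<lambda>k. f k x) \<longlonglongrightarrow> w x"
    and le: "eventually (\<lambda>k. M_seminorm_integral s p (f k) \<le> ennreal d) sequentially"
  shows "M_seminorm_integral s p w \<le> ennreal d"
proof (cases "p = \<infinity>")
  case True
  have "\<bar>w x - w y\<bar> \<le> d * norm (x - y) powr s" for x y
  proof (rule tendsto_upperbound)
    show "(\<lambda>k. \<bar>f k x - f k y\<bar>) \<longlonglongrightarrow> \<bar>w x - w y\<bar>"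
      using lim'[OF True] by (intro tendsto_intros) auto
    show "eventually (\<lambda>k. \<bar>f k x - f k y\<bar> \<le> d * norm (x - y) powr s) sequentially"
      using le
    proof eventually_elim
      case (elim k)
      then have "holder_seminorm s (f k) \<le> ennreal d"
        using True by (simp add: M_seminorm_integral_def)
      then show ?case
        using d by (simp add: holder_seminorm_le_iff)
    qed
  qed simp
  then have "holder_seminorm s w \<le> ennreal d"
    using d by (subst holder_seminorm_le_iff) auto
  then show ?thesis
    using True by (simp add: M_seminorm_integral_def)
next
  case False
  then have "0 < enn2real p"
    using enn2real_ge_1[OF p] by auto
  then have "gagliardo_integral s (enn2real p) w \<le> liminf (\<lambda>k. gagliardo_integral s (enn2real p) (f k))"
    using f lim by (intro gagliardo_integral_Fatou) auto
  also have "\<dots> \<le> ennreal d"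
    by (rule Liminf_le) (use le False in \<open>auto simp: M_seminorm_integral_def\<close>)
  finally show ?thesis
    using False by (simp add: M_seminorm_integral_def)
qed

lemma weighted_Cauchy_AE_convergent:
  fixes V :: "real ^ 'n \<Rightarrow> real" and f :: "nat \<Rightarrow> real ^ 'n \<Rightarrow> real"
  assumes q: "1 \<le> q" and [measurable]: "V \<in> borel_measurable lebesgue" and V: "\<And>x. 0 < V x"
    and [measurable]: "\<And>k. f k \<in> borel_measurable lebesgue"
    and le: "\<And>k. weighted_integral q V (\<lambda>x. f (Suc k) x - f k x) \<le> ennreal (inverse (2 * 2 powr q) ^ k)"
  shows "AE x in lebesgue. convergent (\<lambda>k. f k x)"
proof -
  define g where "g k x = ennreal ((2 powr q) ^ k * (\<bar>f (Suc k) x - f k x\<bar> powr q * V x))" for k x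
  have [measurable]: "g k \<in> borel_measurable lebesgue" for k
    unfolding g_def by measurable
  have g: "integral\<^sup>N lebesgue (g k) \<le> ennreal ((1 / 2) ^ k)" for k
  proof -
    have "integral\<^sup>N lebesgue (g k)
        = (\<integral>\<^sup>+x. ennreal ((2 powr q) ^ k) * ennreal (\<bar>f (Suc k) x - f k x\<bar> powr q * V x) \<partial>lebesgue)"
      unfolding g_def using V by (intro nn_integral_cong ennreal_mult) (auto simp: less_imp_le)
    also have "\<dots> = ennreal ((2 powr q) ^ k) * weighted_integral q V (\<lambda>x. f (Suc k) x - f k x)"
      unfolding weighted_integral_def by (intro nn_integral_cmult) measurable
    also have "\<dots> \<le> ennreal ((2 powr q) ^ k) * ennreal (inverse (2 * 2 powr q) ^ k)"
      by (intro mult_left_mono le) auto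
    also have "\<dots> = ennreal ((2 powr q) ^ k * inverse (2 * 2 powr q) ^ k)"
      by (subst ennreal_mult) auto
    also have "(2 powr q) ^ k * inverse (2 * 2 powr q) ^ k = (1 / 2 :: real) ^ k"
    proof -
      have "2 powr q * inverse (2 * 2 powr q) = (1 / 2 :: real)"
        by (simp add: field_simps)
      then show ?thesis
        by (metis power_mult_distrib)
    qed
    finally show ?thesis .
  qed
  have "(\<integral>\<^sup>+x. (\<Sum>k. g k x) \<partial>lebesgue) = (\<Sum>k. integral\<^sup>N lebesgue (g k))"
    by (rule nn_integral_suminf) measurable
  also have "\<dots> \<le> (\<Sum>k. ennreal ((1 / 2) ^ k))"
    by (intro suminf_le g) auto
  also have "\<dots> = ennreal (\<Sum>k. (1 / 2) ^ k)"
    by (intro suminf_ennreal2 summable_geometric) auto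
  finally have "(\<integral>\<^sup>+x. (\<Sum>k. g k x) \<partial>lebesgue) \<noteq> \<infinity>"
    by (auto simp: top_unique)
  then have "AE x in lebesgue. (\<Sum>k. g k x) \<noteq> \<infinity>"
    by (intro nn_integral_PInf_AE) measurable
  then show ?thesis
  proof eventually_elim
    case (elim x)
    then obtain S where S: "(\<Sum>k. g k x) = ennreal S" "0 \<le> S"
      by (cases "\<Sum>k. g k x") auto
    define T where "T = (S / V x) powr (1 / q)"
    have "norm (f (Suc k) x - f k x) \<le> T * (1 / 2) ^ k" for k
    proof -
      define a where "a = \<bar>f (Suc k) x - f k x\<bar>"
      have "g k x = (\<Sum>i\<in>{k}. g i x)"
        by simp
      also have "\<dots> \<le> (\<Sum>i. g i x)"
        by (rule sum_le_suminf) auto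
      finally have "ennreal ((2 powr q) ^ k * (a powr q * V x)) \<le> ennreal S"
        unfolding S(1) by (simp add: g_def a_def)
      then have "(2 powr q) ^ k * (a powr q * V x) \<le> S"
        using S by (simp add: ennreal_le_iff)
      then have "(2 powr q) ^ k * a powr q \<le> S / V x"
        using V[of x] by (simp add: pos_le_divide_eq mult.assoc)
      also have "(2 powr q) ^ k * a powr q = (2 ^ k * a) powr q"
        by (simp add: powr_mult a_def powr_realpow[symmetric] powr_powr mult.commute)
      finally have "((2 ^ k * a) powr q) powr (1 / q) \<le> T"
        unfolding T_def using q by (intro powr_mono2) auto
      then have "2 ^ k * a \<le> T"
        using q by (simp add: powr_powr a_def)
      then show ?thesis
        by (simp add: a_def field_simps)
    qed
    moreover have "summable (\<lambda>k. T * (1 / 2) ^ k)"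
      by (intro summable_mult summable_geometric) auto
    ultimately have "summable (\<lambda>k. f (Suc k) x - f k x)"
      by (rule summable_comparison_test'[where N = 0 and g = "\<lambda>k. T * (1 / 2) ^ k", rotated])
    then have "convergent (\<lambda>n. (\<Sum>k<n. f (Suc k) x - f k x))"
      by (simp add: summable_iff_convergent)
    then have "convergent (\<lambda>n. f n x - f 0 x)"
      by (simp add: sum_lessThan_telescope[of "\<lambda>n. f n x"])
    then show ?case
      using convergent_add[OF _ convergent_const[of "f 0 x"], of "\<lambda>n. f n x - f 0 x"] by simp
  qed
qed

theorem C1c_subset_M_space:
  assumes "\<phi> \<in> C1c" "M_norm s q p V \<phi> < \<infinity>" "1 \<le> q" "1 \<le> p"
  shows "\<phi> \<in> M_space s q p V"
proof -
  have "continuous_on UNIV \<phi>"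
    using assms(1) unfolding C1c_def
    by (auto intro!: continuous_at_imp_continuous_on intro: has_derivative_continuous)
  then have "\<phi> \<in> borel_measurable lebesgue"
    by (intro measurable_completion) (simp add: borel_measurable_continuous_onI)
  moreover have "M_norm s q p V (\<lambda>x. \<phi> x - \<phi> x) = 0"
  proof -
    have "weighted_norm q V (\<lambda>x. \<phi> x - \<phi> x) = 0"
      by (simp add: weighted_norm_def weighted_integral_def ennpowr_def)
    moreover have "holder_seminorm s (\<lambda>x. \<phi> x - \<phi> x) \<le> ennreal 0"
      by (subst holder_seminorm_le_iff) auto
    moreover have "ennpowr (gagliardo_integral s P (\<lambda>x. \<phi> x - \<phi> x)) (1 / P) = 0" for P
      by (simp add: gagliardo_integral_def ennpowr_def)
    ultimately show ?thesis
      by (simp add: M_norm_def gagliardo_seminorm_def)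
  qed
  ultimately show ?thesis
    using assms unfolding M_space_def by (auto intro!: exI[of _ "\<lambda>_. \<phi>"])
qed

theorem M_space_complete:
  fixes V :: "real ^ 'n \<Rightarrow> real" and u :: "nat \<Rightarrow> real ^ 'n \<Rightarrow> real"
  assumes q: "1 \<le> q" and p: "1 \<le> p"
    and V[measurable]: "V \<in> borel_measurable lebesgue" and Vpos: "\<And>x. 0 < V x"
    and u: "\<And>k. u k \<in> M_space s q p V"
    and Cauchy: "\<And>e. 0 < e \<Longrightarrow> \<exists>N. \<forall>i\<ge>N. \<forall>j\<ge>N. M_norm s q p V (\<lambda>x. u i x - u j x) \<le> ennreal e"
  shows "\<exists>v\<in>M_space s q p V. (\<lambda>k. M_norm s q p V (\<lambda>x. u k x - v x)) \<longlonglongrightarrow> 0"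
proof -
  have um[measurable]: "u k \<in> borel_measurable lebesgue" for k
    using u[of k] by (simp add: M_space_def)
  have Cauchy': "\<exists>N. \<forall>i\<ge>N. \<forall>j\<ge>N. weighted_integral q V (\<lambda>x. u i x - u j x) \<le> ennreal e \<and>
      M_seminorm_integral s p (\<lambda>x. u i x - u j x) \<le> ennreal e" if e: "0 < e" for e
  proof -
    obtain d where "0 < d" "\<And>w :: real ^ 'n \<Rightarrow> real. M_norm s q p V w \<le> ennreal d \<Longrightarrow>
      weighted_integral q V w \<le> ennreal e \<and> M_seminorm_integral s p w \<le> ennreal e"
      using M_norm_smallD[OF q p e] by metis
    with Cauchy[of d] show ?thesis
      by blast
  qed
  define c where "c k = inverse (2 * 2 powr q) ^ k" for k :: nat
  have "\<forall>k. \<exists>N. \<forall>i\<ge>N. \<forall>j\<ge>N. weighted_integral q V (\<lambda>x. u i x - u j x) \<le> ennreal (c k)"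
  proof
    fix k
    have "0 < c k"
      by (simp add: c_def)
    from Cauchy'[OF this]
    show "\<exists>N. \<forall>i\<ge>N. \<forall>j\<ge>N. weighted_integral q V (\<lambda>x. u i x - u j x) \<le> ennreal (c k)"
      by blast
  qed
  then obtain N where N: "\<And>k i j. i \<ge> N k \<Longrightarrow> j \<ge> N k \<Longrightarrow>
      weighted_integral q V (\<lambda>x. u i x - u j x) \<le> ennreal (c k)"
    by metis
  define \<sigma> where "\<sigma> k = k + (\<Sum>i\<le>k. N i)" for k
  have \<sigma>: "N k \<le> \<sigma> k" "k \<le> \<sigma> k" "\<sigma> k \<le> \<sigma> (Suc k)" for k
    by (auto simp: \<sigma>_def intro!: trans_le_add2 member_le_sum)
  have ae: "AE x in lebesgue. convergent (\<lambda>k. u (\<sigma> k) x)"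
  proof (rule weighted_Cauchy_AE_convergent[OF q V Vpos])
    show "weighted_integral q V (\<lambda>x. u (\<sigma> (Suc k)) x - u (\<sigma> k) x) \<le> ennreal (inverse (2 * 2 powr q) ^ k)" for k
      using N[of k "\<sigma> (Suc k)" "\<sigma> k"] \<sigma>[of k] by (auto simp: c_def)
  qed measurable
  have everywhere: "convergent (\<lambda>k. u (\<sigma> k) x)" if "p = \<infinity>" for x
  proof -
    obtain y where y: "convergent (\<lambda>k. u (\<sigma> k) y)"
    proof (rule ccontr)
      assume "\<not> thesis"
      then have "\<not> convergent (\<lambda>k. u (\<sigma> k) y)" for y
        using that by blast
      with ae have "AE y::real^'n in lebesgue. False"
        by simp
      then have "emeasure lebesgue (UNIV :: (real ^ 'n) set) = 0"
        by (simp add: AE_iff_measurable[of UNIV])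
      then show False
        by simp
    qed
    have "Cauchy (\<lambda>k. u (\<sigma> k) x)"
      unfolding Cauchy_def
    proof (intro allI impI)
      fix e :: real assume e: "0 < e"
      define C where "C = norm (x - y) powr s + 1"
      have C: "0 < C"
        by (simp add: C_def add_nonneg_pos)
      obtain N1 where N1: "\<And>i j. i \<ge> N1 \<Longrightarrow> j \<ge> N1 \<Longrightarrow> \<bar>u (\<sigma> i) y - u (\<sigma> j) y\<bar> < e / 2"
        using convergent_Cauchy[OF y] e unfolding Cauchy_def dist_real_def by (meson half_gt_zero)
      obtain N2 where N2: "\<And>i j. i \<ge> N2 \<Longrightarrow> j \<ge> N2 \<Longrightarrow>
          M_seminorm_integral s p (\<lambda>x. u i x - u j x) \<le> ennreal (e / 2 / C)"
        using Cauchy'[of "e / 2 / C"] e C by auto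
      have "dist (u (\<sigma> i) x) (u (\<sigma> j) x) < e" if ij: "i \<ge> max N1 N2" "j \<ge> max N1 N2" for i j
      proof -
        have "\<sigma> i \<ge> N2" "\<sigma> j \<ge> N2"
          using ij \<sigma>(2)[of i] \<sigma>(2)[of j] by auto
        then have "holder_seminorm s (\<lambda>x. u (\<sigma> i) x - u (\<sigma> j) x) \<le> ennreal (e / 2 / C)"
          using N2[of "\<sigma> i" "\<sigma> j"] \<open>p = \<infinity>\<close> by (simp add: M_seminorm_integral_def)
        then have "\<bar>(u (\<sigma> i) x - u (\<sigma> j) x) - (u (\<sigma> i) y - u (\<sigma> j) y)\<bar> \<le> e / 2 / C * norm (x - y) powr s"
          using e C by (subst (asm) holder_seminorm_le_iff) auto
        also have "\<dots> \<le> e / 2 / C * C"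
          using e C by (intro mult_left_mono) (auto simp: C_def)
        also have "\<dots> = e / 2"
          using C by simp
        finally show ?thesis
          using N1[of i j] ij unfolding dist_real_def by linarith
      qed
      then show "\<exists>M. \<forall>m\<ge>M. \<forall>n\<ge>M. dist (u (\<sigma> m) x) (u (\<sigma> n) x) < e"
        by blast
    qed
    then show ?thesis
      by (simp add: Cauchy_convergent_iff)
  qed
  define v where "v x = lim (\<lambda>k. u (\<sigma> k) x)" for x
  have v[measurable]: "v \<in> borel_measurable lebesgue"
    unfolding v_def by measurable
  have vlim: "AE x in lebesgue. (\<lambda>k. u m x - u (\<sigma> k) x) \<longlonglongrightarrow> u m x - v x" for m
    using ae by eventually_elim (auto simp: v_def convergent_LIMSEQ_iff intro!: tendsto_diff)
  have vlim': "\<forall>x. (\<lambda>k. u m x - u (\<sigma> k) x) \<longlonglongrightarrow> u m x - v x" if "p = \<infinity>" for m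
    using everywhere[OF that] by (auto simp: v_def convergent_LIMSEQ_iff intro!: tendsto_diff)
  have conv: "\<exists>M. \<forall>m\<ge>M. M_norm s q p V (\<lambda>x. u m x - v x) \<le> ennreal e" if e: "0 < e" for e
  proof -
    obtain d where d: "0 < d" "\<And>w :: real ^ 'n \<Rightarrow> real. weighted_integral q V w \<le> ennreal d \<Longrightarrow>
      M_seminorm_integral s p w \<le> ennreal d \<Longrightarrow> M_norm s q p V w \<le> ennreal e"
      using M_norm_smallI[OF q p e] by metis
    obtain M where M: "\<And>i j. i \<ge> M \<Longrightarrow> j \<ge> M \<Longrightarrow> weighted_integral q V (\<lambda>x. u i x - u j x) \<le> ennreal d \<and>
      M_seminorm_integral s p (\<lambda>x. u i x - u j x) \<le> ennreal d"
      using Cauchy'[OF d(1)] by auto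
    have "M_norm s q p V (\<lambda>x. u m x - v x) \<le> ennreal e" if m: "m \<ge> M" for m
    proof (rule d(2))
      have ev: "eventually (\<lambda>k. weighted_integral q V (\<lambda>x. u m x - u (\<sigma> k) x) \<le> ennreal d \<and>
          M_seminorm_integral s p (\<lambda>x. u m x - u (\<sigma> k) x) \<le> ennreal d) sequentially"
        using eventually_ge_at_top[of M]
      proof eventually_elim
        case (elim k)
        then show ?case
          using M[of m "\<sigma> k"] m \<sigma>(2)[of k] by auto
      qed
      have "weighted_integral q V (\<lambda>x. u m x - v x)
          \<le> liminf (\<lambda>k. weighted_integral q V (\<lambda>x. u m x - u (\<sigma> k) x))"
        by (rule weighted_integral_Fatou) (use q vlim in auto)
      also have "\<dots> \<le> ennreal d"
        by (rule Liminf_le) (use ev in \<open>auto elim: eventually_mono\<close>)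
      finally show "weighted_integral q V (\<lambda>x. u m x - v x) \<le> ennreal d" .
      show "M_seminorm_integral s p (\<lambda>x. u m x - v x) \<le> ennreal d"
        by (rule M_seminorm_integral_Fatou[where f = "\<lambda>k x. u m x - u (\<sigma> k) x"])
          (use p d vlim vlim' ev in \<open>auto elim: eventually_mono\<close>)
    qed
    then show ?thesis
      by blast
  qed
  have "\<exists>\<phi>. \<phi> \<in> C1c \<and> M_norm s q p V \<phi> < \<infinity> \<and> M_norm s q p V (\<lambda>x. v x - \<phi> x) \<le> ennreal e"
    if e: "0 < e" for e
  proof -
    obtain d where d: "0 < d" "\<And>u w :: real ^ 'n \<Rightarrow> real. u \<in> borel_measurable lebesgue \<Longrightarrow>
      w \<in> borel_measurable lebesgue \<Longrightarrow> M_norm s q p V u \<le> ennreal d \<Longrightarrow>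
      M_norm s q p V w \<le> ennreal d \<Longrightarrow> M_norm s q p V (\<lambda>x. u x + w x) \<le> ennreal e"
      by (rule M_norm_add_small[OF q p e V Vpos]) (rule that)
    obtain m where m: "M_norm s q p V (\<lambda>x. u m x - v x) \<le> ennreal d"
      using conv[OF d(1)] by auto
    obtain \<phi> where \<phi>: "\<And>k. \<phi> k \<in> C1c" "\<And>k. M_norm s q p V (\<phi> k) < \<infinity>"
      and "(\<lambda>k. M_norm s q p V (\<lambda>x. u m x - \<phi> k x)) \<longlonglongrightarrow> 0"
      using u[of m] unfolding M_space_def by blast
    then have "eventually (\<lambda>k. M_norm s q p V (\<lambda>x. u m x - \<phi> k x) < ennreal d) sequentially"
      using d by (intro order_tendstoD) auto
    then obtain k where k: "M_norm s q p V (\<lambda>x. u m x - \<phi> k x) < ennreal d"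
      by (auto simp: eventually_sequentially)
    have "\<phi> k \<in> M_space s q p V"
      using \<phi> q p by (intro C1c_subset_M_space)
    then have \<phi>m[measurable]: "\<phi> k \<in> borel_measurable lebesgue"
      by (simp add: M_space_def)
    have "M_norm s q p V (\<lambda>x. v x - u m x) = M_norm s q p V (\<lambda>x. - (u m x - v x))"
      by simp
    also have "\<dots> \<le> ennreal d"
      unfolding M_norm_uminus by (rule m)
    finally have "M_norm s q p V (\<lambda>x. (v x - u m x) + (u m x - \<phi> k x)) \<le> ennreal e"
      using k by (intro d(2)) auto
    then show ?thesis
      using \<phi> by (intro exI[of _ "\<phi> k"]) auto
  qed
  then have "\<forall>k. \<exists>\<phi>. \<phi> \<in> C1c \<and> M_norm s q p V \<phi> < \<infinity> \<and>
      M_norm s q p V (\<lambda>x. v x - \<phi> x) \<le> ennreal (1 / real (Suc k))"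
    by simp
  then obtain \<phi> where \<phi>: "\<And>k. \<phi> k \<in> C1c \<and> M_norm s q p V (\<phi> k) < \<infinity>"
    and le: "\<And>k. M_norm s q p V (\<lambda>x. v x - \<phi> k x) \<le> ennreal (1 / real (Suc k))"
    by metis
  have "(\<lambda>k. ennreal (1 / real (Suc k))) \<longlonglongrightarrow> ennreal 0"
    by (intro tendsto_ennrealI LIMSEQ_Suc[OF lim_1_over_n])
  then have lim0: "(\<lambda>k. ennreal (1 / real (Suc k))) \<longlonglongrightarrow> 0"
    by simp
  have "(\<lambda>k. M_norm s q p V (\<lambda>x. v x - \<phi> k x)) \<longlonglongrightarrow> 0"
    by (rule tendsto_sandwich[OF _ _ tendsto_const lim0]) (use le in auto)
  with \<phi> v have "v \<in> M_space s q p V"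
    unfolding M_space_def by blast
  moreover have "(\<lambda>k. M_norm s q p V (\<lambda>x. u k x - v x)) \<longlonglongrightarrow> 0"
  proof (rule order_tendstoI)
    fix a :: ennreal assume "0 < a"
    then obtain b where b: "0 < b" "b < a"
      using dense by blast
    then obtain e where e: "b = ennreal e"
      by (cases b) auto
    then have e: "0 < e" "ennreal e < a"
      using b by auto
    obtain M where M: "\<And>m. m \<ge> M \<Longrightarrow> M_norm s q p V (\<lambda>x. u m x - v x) \<le> ennreal e"
      using conv[OF e(1)] by auto
    show "eventually (\<lambda>k. M_norm s q p V (\<lambda>x. u k x - v x) < a) sequentially"
      using eventually_ge_at_top[of M] by eventually_elim (use M e in \<open>auto intro: le_less_trans\<close>)
  qed auto
  ultimately show ?thesis
    by blast
qed

end

theory Submission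
  imports Defs "HOL-Complex_Analysis.Great_Picard"
begin

text \<open>
  The gain of integrability comes from superlevel sets.  A point where \<open>\<bar>u\<bar> > 2\<lambda>\<close> differs by more
  than \<open>\<lambda>\<close> from every point outside \<open>{\<bar>u\<bar> > \<lambda>}\<close>, and outside a set of measure \<open>a\<close> the kernel
  \<open>1 / \<bar>x - y\<bar>^(n + sp)\<close> still has mass of order \<open>a powr (- sp/n)\<close>.  For \<open>sp \<ge> n\<close> the measure of
  \<open>{\<bar>u\<bar> > 2^(k+1)}\<close> is therefore at most \<open>C 2^(- pk)\<close> times that of \<open>{\<bar>u\<bar> > 2^k}\<close>, which bounds every
  \<open>L^m\<close> norm with \<open>m \<ge> q\<close>.  Up to a set of small measure, a function bounded in the space is
  controlled by finitely many of its integrals over small balls, so a diagonal subsequence along which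
  the integrals over countably many balls converge is Cauchy in measure.  Pointwise Young inequalities
  make it Cauchy for the weight \<open>K\<close>: on the set where \<open>K V^(- \<tau>)\<close> is large, which has finite measure,
  \<open>K\<close> is split off with its exponent \<open>t\<close>, and elsewhere \<open>\<bar>u\<bar>^r K\<close> is at most a small multiple of
  \<open>\<bar>u\<bar>^q V + \<bar>u\<bar>^m\<close> with \<open>m = (r - q\<tau>) / (1 - \<tau>)\<close>.
\<close>

subsection \<open>Higher integrability\<close>

lemma le_divide_ennrealI:
  assumes "0 < c" "0 \<le> G" "ennreal c * x \<le> ennreal G"
  shows "x \<le> ennreal (G / c)"
proof -
  obtain y where y: "x = ennreal y" "0 \<le> y"
    using assms by (cases x) (auto simp: ennreal_mult_top top_unique)
  then have "c * y \<le> G"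
    using assms by (simp flip: ennreal_mult)
  then show ?thesis
    using y assms by (simp add: ennreal_le_iff field_simps)
qed

lemma sets_lebesgue_superlevel [measurable]:
  fixes u :: "real ^ 'n \<Rightarrow> real"
  assumes [measurable]: "u \<in> borel_measurable lebesgue"
  shows "{x. c < \<bar>u x\<bar>} \<in> sets lebesgue"
proof -
  have "{x \<in> space lebesgue. c < \<bar>u x\<bar>} \<in> sets lebesgue"
    by measurable
  then show ?thesis
    by simp
qed

text \<open>Around a point where |u| > 2l, take the ball with twice the volume of
  \<open>{x. l < \<bar>u x\<bar>}\<close>. At least half of it lies outside that set, and there
  \<open>u\<close> differs from its central value by more than \<open>l\<close>. The measure itself
  stays on the right, beside an a priori bound \<open>M\<close> for it, so that the estimate can be
  iterated over levels.\<close>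

lemma superlevel_decay:
  fixes u :: "real ^ 'n \<Rightarrow> real" and s p l M G :: real
  defines "v \<equiv> unit_ball_vol (real CARD('n))"
  assumes u[measurable]: "u \<in> borel_measurable lebesgue"
    and p: "0 < p" and sp: "real CARD('n) \<le> s * p"
    and G: "gagliardo_integral s p u \<le> ennreal G" "0 \<le> G"
    and l: "0 < l" and M: "0 < M" "emeasure lebesgue {x. l < \<bar>u x\<bar>} \<le> ennreal M"
  shows "emeasure lebesgue {x. 2 * l < \<bar>u x\<bar>}
    \<le> ennreal (G * (4 / v\<^sup>2) * ((2 * M / v) powr (1 / CARD('n))) powr (s * p - CARD('n)) * l powr (- p))
      * emeasure lebesgue {x. l < \<bar>u x\<bar>}"
proof -
  define n where "n = real CARD('n)"
  have n: "0 < n" by (simp add: n_def)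
  have v: "0 < v" by (simp add: v_def)
  define A where "A = {x. l < \<bar>u x\<bar>}"
  define A2 where "A2 = {x. 2 * l < \<bar>u x\<bar>}"
  define R where "R = (2 * M / v) powr (1 / n)"
  have Am[measurable]: "A \<in> sets lebesgue" "A2 \<in> sets lebesgue"
    unfolding A_def A2_def by simp_all
  have fin: "emeasure lebesgue A \<noteq> \<infinity>"
    using M(2) by (auto simp: A_def top_unique)
  define a where "a = measure lebesgue A"
  have a: "emeasure lebesgue A = ennreal a" "0 \<le> a"
    using fin by (auto simp: a_def emeasure_eq_ennreal_measure)
  have aM: "a \<le> M"
    using M a by (simp add: A_def)
  have "emeasure lebesgue A2 \<le> ennreal (G * (4 / v\<^sup>2) * R powr (s * p - n) * l powr (- p)) * ennreal a"
  proof (cases "a = 0")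
    \<comment> \<open>A set of measure 0 gives no ball to work with; here the inclusion of the
      superlevel sets suffices.\<close>
    case True
    have "emeasure lebesgue A2 \<le> emeasure lebesgue A"
      using l by (intro emeasure_mono) (auto simp: A_def A2_def)
    with True a show ?thesis by simp
  next
    case False
    with a have a0: "0 < a" by simp
    \<comment> \<open>The radius of a ball of volume \<open>2 * a\<close>.\<close>
    define \<rho> where "\<rho> = (2 * a / v) powr (1 / n)"
    have \<rho>: "0 < \<rho>" using a0 v by (simp add: \<rho>_def)
    have \<rho>R: "\<rho> \<le> R"
      unfolding \<rho>_def R_def using a0 aM v n by (intro powr_mono2 divide_right_mono) auto
    have \<rho>n: "\<rho> powr n = 2 * a / v"
      unfolding \<rho>_def using n a0 v by (simp add: powr_powr)
    have \<rho>n': "\<rho> ^ CARD('n) = 2 * a / v"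
      using \<rho>n \<rho> by (simp add: n_def powr_realpow)
    define b where "b = n + s * p"
    define \<kappa> where "\<kappa> = l powr p / \<rho> powr b"
    have \<kappa>: "0 < \<kappa>" using l \<rho> by (simp add: \<kappa>_def)
    have inner: "ennreal (\<kappa> * a) \<le> (\<integral>\<^sup>+y. ennreal (\<bar>u x - u y\<bar> powr p / norm (x - y) powr b) \<partial>lebesgue)"
      if x: "x \<in> A2" for x
    proof -
      have "ennreal (2 * a) = emeasure lebesgue (ball x \<rho>)"
        using \<rho> \<rho>n' v by (simp add: emeasure_ball v_def[symmetric])
      also have "\<dots> \<le> emeasure lebesgue ((ball x \<rho> - A) \<union> A)"
        by (intro emeasure_mono) auto
      also have "\<dots> \<le> emeasure lebesgue (ball x \<rho> - A) + emeasure lebesgue A"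
        by (intro emeasure_subadditive) auto
      finally have "ennreal a + ennreal a \<le> emeasure lebesgue (ball x \<rho> - A) + ennreal a"
        using a0 by (simp add: a(1) flip: ennreal_plus)
      then have "ennreal a \<le> emeasure lebesgue (ball x \<rho> - A)"
        by (simp add: add.commute ennreal_add_left_cancel_le)
      then have "ennreal (\<kappa> * a) \<le> ennreal \<kappa> * emeasure lebesgue (ball x \<rho> - A)"
        using \<kappa> a0 by (simp add: ennreal_mult mult_left_mono)
      also have "\<dots> = (\<integral>\<^sup>+y. ennreal \<kappa> * indicator (ball x \<rho> - A) y \<partial>lebesgue)"
        by (subst nn_integral_cmult_indicator) auto
      also have "\<dots> \<le> (\<integral>\<^sup>+y. ennreal (\<bar>u x - u y\<bar> powr p / norm (x - y) powr b) \<partial>lebesgue)"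
      proof (rule nn_integral_mono)
        fix y
        show "ennreal \<kappa> * indicator (ball x \<rho> - A) y
          \<le> ennreal (\<bar>u x - u y\<bar> powr p / norm (x - y) powr b)"
        proof (cases "y \<in> ball x \<rho> - A")
          case True
          then have "l < \<bar>u x - u y\<bar>" "x \<noteq> y"
            using x l by (auto simp: A_def A2_def)
          then have "\<kappa> \<le> \<bar>u x - u y\<bar> powr p / norm (x - y) powr b"
            unfolding \<kappa>_def using True l p n sp
            by (intro frac_le powr_mono2) (auto simp: dist_norm b_def n_def)
          with True show ?thesis by (simp add: ennreal_leI)
        qed simp
      qed
      finally show ?thesis .
    qed
    have "ennreal (\<kappa> * a) * emeasure lebesgue A2 = (\<integral>\<^sup>+x. ennreal (\<kappa> * a) * indicator A2 x \<partial>lebesgue)"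
      by (subst nn_integral_cmult_indicator) auto
    also have "\<dots> \<le> gagliardo_integral s p u"
      unfolding gagliardo_integral_def
      by (intro nn_integral_mono) (use inner in \<open>auto simp: b_def n_def split: split_indicator\<close>)
    also have "\<dots> \<le> ennreal G" by (rule G)
    finally have le: "ennreal (\<kappa> * a) * emeasure lebesgue A2 \<le> ennreal G" .
    have ka: "0 < \<kappa> * a" using \<kappa> a0 by simp
    have "emeasure lebesgue A2 \<le> ennreal (G / (\<kappa> * a))"
      using ka G le by (intro le_divide_ennrealI)
    also have "\<dots> \<le> ennreal (G * (4 / v\<^sup>2) * R powr (s * p - n) * l powr (- p) * a)"
    proof (rule ennreal_leI)
      \<comment> \<open>The exponent n + sp is split as n + n + (sp - n). The first two factors give
        a multiple of a^2, of which the division by \<open>a\<close> leaves one power; the last has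
        a nonnegative exponent because sp \<ge> n, so \<open>R\<close> may replace \<rho>.\<close>
      have "\<rho> powr b = \<rho> powr n * \<rho> powr n * \<rho> powr (s * p - n)"
        by (simp add: b_def flip: powr_add)
      also have "\<dots> = (2 * a / v)\<^sup>2 * \<rho> powr (s * p - n)"
        by (simp add: \<rho>n power2_eq_square)
      also have "\<dots> \<le> (2 * a / v)\<^sup>2 * R powr (s * p - n)"
        using \<rho> \<rho>R sp by (intro mult_left_mono powr_mono2) (auto simp: n_def)
      finally have "\<rho> powr b / a \<le> (2 * a / v)\<^sup>2 * R powr (s * p - n) / a"
        using a0 by (intro divide_right_mono) auto
      also have "\<dots> = 4 / v\<^sup>2 * R powr (s * p - n) * a"
        using a0 by (simp add: power2_eq_square)
      finally have "G * l powr (- p) * (\<rho> powr b / a) \<le> G * l powr (- p) * (4 / v\<^sup>2 * R powr (s * p - n) * a)"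
        using G by (intro mult_left_mono) auto
      moreover have "G / (\<kappa> * a) = G * l powr (- p) * (\<rho> powr b / a)"
        using l \<rho> by (simp add: \<kappa>_def powr_minus field_simps)
      ultimately show "G / (\<kappa> * a) \<le> G * (4 / v\<^sup>2) * R powr (s * p - n) * l powr (- p) * a"
        by (simp add: mult_ac)
    qed
    finally show ?thesis
      using G v a0 by (subst ennreal_mult[symmetric]) auto
  qed
  then show ?thesis
    unfolding A_def[symmetric] A2_def[symmetric] a n_def[symmetric] R_def by simp
qed

lemma chebyshev_powr:
  fixes u :: "real ^ 'n \<Rightarrow> real"
  assumes [measurable]: "u \<in> borel_measurable lebesgue" and "0 < q" "0 < c"
    and le: "weighted_integral q (\<lambda>_. 1) u \<le> ennreal A" and "0 \<le> A"
  shows "emeasure lebesgue {x. c < \<bar>u x\<bar>} \<le> ennreal (A / c powr q)"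
proof (rule le_divide_ennrealI)
  have "ennreal (c powr q) * emeasure lebesgue {x. c < \<bar>u x\<bar>}
      = (\<integral>\<^sup>+x. ennreal (c powr q) * indicator {x. c < \<bar>u x\<bar>} x \<partial>lebesgue)"
    by (subst nn_integral_cmult_indicator) simp_all
  also have "\<dots> \<le> weighted_integral q (\<lambda>_. 1) u"
    unfolding weighted_integral_def using assms
    by (intro nn_integral_mono) (auto split: split_indicator intro!: ennreal_leI powr_mono2)
  finally show "ennreal (c powr q) * emeasure lebesgue {x. c < \<bar>u x\<bar>} \<le> ennreal A"
    using le by (rule order_trans)
qed (use assms in auto)

section \<open>Dyadic summation over superlevel sets\<close>

lemma power_powr_commute: "((2 :: real) ^ k) powr a = (2 powr a) ^ k"
  by (induction k) (simp_all add: powr_mult)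

text \<open>The ratio of consecutive terms is \<open>c * D * d ^ k\<close>, which tends to 0.
  Equivalently, \<open>b k\<close> equals b 0 * D^k * d^(k(k-1)/2), and this beats every geometric
  growth \<open>c ^ k\<close>.\<close>

lemma summable_gaussian_product:
  fixes b :: "nat \<Rightarrow> real"
  assumes "\<And>k. 0 \<le> b k" "\<And>k. b (Suc k) = D * d ^ k * b k" "0 \<le> D" "0 \<le> d" "d < 1" "0 \<le> c"
  shows "summable (\<lambda>k. c ^ k * b k)"
proof -
  have "(\<lambda>k. c * D * d ^ k) \<longlonglongrightarrow> c * D * 0"
    using assms by (intro tendsto_mult_left LIMSEQ_power_zero) auto
  then have "eventually (\<lambda>k. c * D * d ^ k < 1 / 2) sequentially"
    by (intro order_tendstoD) auto
  then obtain N where N: "\<And>k. k \<ge> N \<Longrightarrow> c * D * d ^ k < 1 / 2"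
    by (auto simp: eventually_sequentially)
  show ?thesis
  proof (rule summable_ratio_test[of "1 / 2" N])
    fix k assume "N \<le> k"
    have "c ^ Suc k * b (Suc k) = (c * D * d ^ k) * (c ^ k * b k)"
      by (simp add: assms(2) mult_ac)
    also have "\<dots> \<le> 1 / 2 * (c ^ k * b k)"
      using N[OF \<open>N \<le> k\<close>] assms by (intro mult_right_mono) auto
    finally show "norm (c ^ Suc k * b (Suc k)) \<le> 1 / 2 * norm (c ^ k * b k)"
      using assms by (simp add: abs_mult)
  qed simp
qed

text \<open>Where |u| \<le> 1 the larger exponent gives the smaller power. On a layer 2^k < |u|
  \<le> 2^(k+1) the power is at most 2^(m(k+1)), whence the \<open>Suc k\<close> in the
  series.\<close>

lemma Lebesgue_bound_of_superlevel:
  fixes u :: "real ^ 'n \<Rightarrow> real" and q m A :: real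
  assumes [measurable]: "u \<in> borel_measurable lebesgue" and qm: "0 < q" "q \<le> m"
    and A: "weighted_integral q (\<lambda>_. 1) u \<le> ennreal A"
    and b: "\<And>k. 0 \<le> b k" "\<And>k. emeasure lebesgue {x. 2 ^ k < \<bar>u x\<bar>} \<le> ennreal (b k)"
    and summable: "summable (\<lambda>k. (2 powr m) ^ Suc k * b k)"
  shows "weighted_integral m (\<lambda>_. 1) u \<le> ennreal A + ennreal (\<Sum>k. (2 powr m) ^ Suc k * b k)"
proof -
  define F where "F k x = ennreal ((2 powr m) ^ Suc k) * indicator {x. 2 ^ k < \<bar>u x\<bar>} x" for k x
  have [measurable]: "F k \<in> borel_measurable lebesgue" for k
    unfolding F_def by measurable
  have "weighted_integral m (\<lambda>_. 1) u \<le> (\<integral>\<^sup>+x. ennreal (\<bar>u x\<bar> powr q * 1) + (\<Sum>k. F k x) \<partial>lebesgue)"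
    unfolding weighted_integral_def
  proof (rule nn_integral_mono)
    fix x
    show "ennreal (\<bar>u x\<bar> powr m * 1) \<le> ennreal (\<bar>u x\<bar> powr q * 1) + (\<Sum>k. F k x)"
    proof (cases "\<bar>u x\<bar> \<le> 1")
      case True
      then have "\<bar>u x\<bar> powr m \<le> \<bar>u x\<bar> powr q"
        using qm by (intro powr_mono') auto
      then show ?thesis
        by (intro add_increasing2) (auto intro!: ennreal_leI)
    next
      case False
      obtain j where j: "\<bar>u x\<bar> \<le> 2 ^ j"
        using real_arch_pow[of 2 "\<bar>u x\<bar>"] by (auto intro: less_imp_le)
      \<comment> \<open>The least such exponent is positive because |u x| > 1, so its predecessor
        \<open>k\<close> places x in the layer 2^k < |u| \<le> 2^(k+1).\<close>
      define i where "i = (LEAST j. \<bar>u x\<bar> \<le> 2 ^ j)"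
      have i: "\<bar>u x\<bar> \<le> 2 ^ i"
        unfolding i_def by (rule LeastI[of _ j]) (rule j)
      with False obtain k where k: "i = Suc k"
        by (cases i) auto
      have "\<not> \<bar>u x\<bar> \<le> 2 ^ k"
        using not_less_Least[of k "\<lambda>j. \<bar>u x\<bar> \<le> 2 ^ j"] k by (simp add: i_def)
      then have "F k x = ennreal ((2 powr m) ^ Suc k)"
        by (simp add: F_def)
      also have "(2 powr m) ^ Suc k = (2 ^ Suc k :: real) powr m"
        by (simp only: power_powr_commute)
      finally have "ennreal (\<bar>u x\<bar> powr m) \<le> F k x"
        using i k qm by (auto intro!: ennreal_leI powr_mono2)
      also have "\<dots> = (\<Sum>i\<in>{k}. F i x)"
        by simp
      also have "\<dots> \<le> (\<Sum>i. F i x)"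
        by (rule sum_le_suminf) auto
      finally show ?thesis
        by (intro add_increasing) auto
    qed
  qed
  also have "\<dots> = weighted_integral q (\<lambda>_. 1) u + (\<Sum>k. \<integral>\<^sup>+x. F k x \<partial>lebesgue)"
    unfolding weighted_integral_def by (simp add: nn_integral_add nn_integral_suminf)
  also have "(\<Sum>k. \<integral>\<^sup>+x. F k x \<partial>lebesgue) \<le> (\<Sum>k. ennreal ((2 powr m) ^ Suc k * b k))"
  proof (intro suminf_le)
    fix k
    have "(\<integral>\<^sup>+x. F k x \<partial>lebesgue) = ennreal ((2 powr m) ^ Suc k) * emeasure lebesgue {x. 2 ^ k < \<bar>u x\<bar>}"
      unfolding F_def by (subst nn_integral_cmult_indicator) simp_all
    also have "\<dots> \<le> ennreal ((2 powr m) ^ Suc k) * ennreal (b k)"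
      by (intro mult_left_mono b) simp
    finally show "(\<integral>\<^sup>+x. F k x \<partial>lebesgue) \<le> ennreal ((2 powr m) ^ Suc k * b k)"
      using b by (simp add: ennreal_mult)
  qed auto
  also have "\<dots> = ennreal (\<Sum>k. (2 powr m) ^ Suc k * b k)"
    using b summable by (intro suminf_ennreal2) auto
  finally show ?thesis
    using A by (meson add_mono order_trans order_refl)
qed

text \<open>Iterating \<open>superlevel_decay\<close> over the levels 2^k gives superlevel measures
  that decay faster than any geometric sequence, hence a convergent dyadic sum for every
  \<open>m\<close>. The bound depends on \<open>u\<close> only through \<open>A\<close>.\<close>

lemma gagliardo_Lebesgue_bound:
  assumes p: "0 < p" and sp: "real CARD('n) \<le> s * p" and q: "0 < q" "q \<le> m" and A: "0 < A"
  shows "\<exists>C>0. \<forall>u \<in> borel_measurable lebesgue. weighted_integral q (\<lambda>_. 1) (u :: real ^ 'n \<Rightarrow> real) \<le> ennreal A \<longrightarrow>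
    gagliardo_integral s p u \<le> ennreal A \<longrightarrow> weighted_integral m (\<lambda>_. 1) u \<le> ennreal C"
proof -
  define v where "v = unit_ball_vol (real CARD('n))"
  \<comment> \<open>The constant of \<open>superlevel_decay\<close> with \<open>A\<close> in both
    roles, as bound \<open>G\<close> of the seminorm integral and as bound \<open>M\<close> of the
    superlevel measure.\<close>
  define D where "D = A * (4 / v\<^sup>2) * ((2 * A / v) powr (1 / CARD('n))) powr (s * p - CARD('n))"
  have D: "0 \<le> D"
    using A by (simp add: D_def)
  define d where "d = (2::real) powr (- p)"
  have d: "0 \<le> d" "d < 1"
    using p by (auto simp: d_def powr_minus inverse_less_1_iff)
  \<comment> \<open>A majorant for the measure of {|u| > 2^k}: going from the level 2^k to the next
    one costs the factor \<open>D * (2 ^ k) powr (- p)\<close>, which is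
    \<open>D * d ^ k\<close>.\<close>
  define b where "b = rec_nat A (\<lambda>k b. D * d ^ k * b)"
  have b0: "b 0 = A" and bS: "b (Suc k) = D * d ^ k * b k" for k
    by (simp_all add: b_def)
  have b: "0 \<le> b k" for k
    by (induction k) (use A D d in \<open>auto simp: b0 bS\<close>)
  define S where "S = (\<Sum>k. (2 powr m) ^ Suc k * b k)"
  have "summable (\<lambda>k. (2 powr m) ^ k * b k)"
    by (rule summable_gaussian_product[OF b bS D d]) simp
  from summable_mult[OF this, of "2 powr m"]
  have S: "summable (\<lambda>k. (2 powr m) ^ Suc k * b k)"
    by (simp add: mult.assoc)
  have S0: "0 \<le> S"
    unfolding S_def using b by (intro suminf_nonneg[OF S]) auto
  show ?thesis
  proof (intro exI[of _ "A + S"] conjI ballI impI)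
    fix u :: "real ^ 'n \<Rightarrow> real"
    assume u[measurable]: "u \<in> borel_measurable lebesgue"
      and uA: "weighted_integral q (\<lambda>_. 1) u \<le> ennreal A" and G: "gagliardo_integral s p u \<le> ennreal A"
    \<comment> \<open>All levels are at least 1, so Chebyshev's inequality yields the same bound
      \<open>A\<close> at each of them, and one \<open>D\<close> serves for all
      \<open>k\<close>.\<close>
    have le_A: "emeasure lebesgue {x. 2 ^ k < \<bar>u x\<bar>} \<le> ennreal A" for k :: nat
    proof -
      have "emeasure lebesgue {x. 2 ^ k < \<bar>u x\<bar>} \<le> ennreal (A / (2 ^ k) powr q)"
        using A q uA by (intro chebyshev_powr) auto
      also have "\<dots> \<le> ennreal A"
        using A q by (intro ennreal_leI) (simp add: divide_le_eq ge_one_powr_ge_zero)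
      finally show ?thesis .
    qed
    have "emeasure lebesgue {x. 2 ^ k < \<bar>u x\<bar>} \<le> ennreal (b k)" for k
    proof (induction k)
      case 0
      then show ?case
        using le_A[of 0] by (simp add: b0)
    next
      case (Suc k)
      have "emeasure lebesgue {x. 2 * 2 ^ k < \<bar>u x\<bar>}
          \<le> ennreal (D * (2 ^ k) powr (- p)) * emeasure lebesgue {x. 2 ^ k < \<bar>u x\<bar>}"
        unfolding D_def v_def using A p by (intro superlevel_decay[OF u p sp G _ _ _ le_A]) auto
      also have "\<dots> \<le> ennreal (D * d ^ k) * ennreal (b k)"
      proof -
        have "(2 ^ k) powr (- p) = d ^ k"
          by (simp only: d_def power_powr_commute)
        then show ?thesis
          using Suc by (simp only:) (intro mult_left_mono, auto)
      qed
      finally show ?case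
        using D d b by (simp add: bS ennreal_mult)
    qed
    with S b have "weighted_integral m (\<lambda>_. 1) u \<le> ennreal A + ennreal S"
      unfolding S_def using q by (intro Lebesgue_bound_of_superlevel[OF u _ _ uA]) auto
    then show "weighted_integral m (\<lambda>_. 1) u \<le> ennreal (A + S)"
      using A S0 by simp
  qed (use A S0 in auto)
qed

text \<open>Over unit distance \<open>u\<close> changes by at most \<open>A\<close>. A value above A
  + A/v + 1 would therefore keep |u| above c = A/v + 1 on a whole unit ball, and Chebyshev's
  inequality would give v \<le> A / c^q, although c^q \<ge> c > A/v.\<close>

lemma holder_bounded:
  fixes u :: "real ^ 'n \<Rightarrow> real"
  defines "v \<equiv> unit_ball_vol (real CARD('n))"
  assumes u[measurable]: "u \<in> borel_measurable lebesgue" and s: "0 < s" and q: "1 \<le> q" and A: "0 < A"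
    and le: "weighted_integral q (\<lambda>_. 1) u \<le> ennreal A" and H: "holder_seminorm s u \<le> ennreal A"
  shows "\<bar>u x\<bar> \<le> A + A / v + 1"
proof (rule ccontr)
  assume *: "\<not> ?thesis"
  have v: "0 < v" by (simp add: v_def)
  define c where "c = A / v + 1"
  have c: "1 < c" "A / v < c" using A v by (auto simp: c_def)
  have "ball x 1 \<subseteq> {x. c < \<bar>u x\<bar>}"
  proof
    fix y assume y: "y \<in> ball x 1"
    have "\<bar>u x - u y\<bar> \<le> A * norm (x - y) powr s"
      using H A by (simp add: holder_seminorm_le_iff)
    also have "\<dots> \<le> A * 1 powr s"
      using A s y by (intro mult_left_mono powr_mono2) (auto simp: dist_norm)
    finally show "y \<in> {x. c < \<bar>u x\<bar>}"
      using * by (auto simp: c_def)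
  qed
  then have "emeasure lebesgue (ball x 1) \<le> emeasure lebesgue {x. c < \<bar>u x\<bar>}"
    by (rule emeasure_mono) simp
  also have "\<dots> \<le> ennreal (A / c powr q)"
    using A q c le by (intro chebyshev_powr) auto
  finally have "v \<le> A / c powr q"
    using A by (simp add: emeasure_ball v_def ennreal_le_iff)
  then have "c powr q * v \<le> A"
    using c by (simp add: field_simps)
  moreover have "A < c * v"
    using c v by (simp add: field_simps)
  moreover have "c * v \<le> c powr q * v"
    using c q v powr_mono[of 1 q c] by (intro mult_right_mono) auto
  ultimately show False
    by simp
qed

text \<open>With the uniform bound \<open>B\<close> for |u|, the power |u|^m is at most B^(m-q)
  |u|^q.\<close>

lemma holder_Lebesgue_bound:
  assumes s: "0 < s" and q: "1 \<le> q" "q \<le> m" and A: "0 < A"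
  shows "\<exists>C>0. \<forall>u \<in> borel_measurable lebesgue. weighted_integral q (\<lambda>_. 1) (u :: real ^ 'n \<Rightarrow> real) \<le> ennreal A \<longrightarrow>
    holder_seminorm s u \<le> ennreal A \<longrightarrow> weighted_integral m (\<lambda>_. 1) u \<le> ennreal C"
proof -
  define B where "B = A + A / unit_ball_vol (real CARD('n)) + 1"
  have B: "0 < B"
    using A by (simp add: B_def add_pos_pos)
  show ?thesis
  proof (intro exI[of _ "B powr (m - q) * A"] conjI ballI impI)
    fix u :: "real ^ 'n \<Rightarrow> real"
    assume u[measurable]: "u \<in> borel_measurable lebesgue"
      and uA: "weighted_integral q (\<lambda>_. 1) u \<le> ennreal A" and H: "holder_seminorm s u \<le> ennreal A"
    have "weighted_integral m (\<lambda>_. 1) u \<le> (\<integral>\<^sup>+x. ennreal (B powr (m - q)) * ennreal (\<bar>u x\<bar> powr q * 1) \<partial>lebesgue)"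
      unfolding weighted_integral_def
    proof (rule nn_integral_mono)
      fix x
      have "\<bar>u x\<bar> \<le> B"
        unfolding B_def by (rule holder_bounded[OF u s q(1) A uA H])
      then have "\<bar>u x\<bar> powr (m - q) * \<bar>u x\<bar> powr q \<le> B powr (m - q) * \<bar>u x\<bar> powr q"
        using q by (intro mult_right_mono powr_mono2) auto
      then show "ennreal (\<bar>u x\<bar> powr m * 1) \<le> ennreal (B powr (m - q)) * ennreal (\<bar>u x\<bar> powr q * 1)"
        by (simp add: ennreal_leI flip: ennreal_mult powr_add)
    qed
    also have "\<dots> = ennreal (B powr (m - q)) * weighted_integral q (\<lambda>_. 1) u"
      unfolding weighted_integral_def by (intro nn_integral_cmult) measurable
    also have "\<dots> \<le> ennreal (B powr (m - q)) * ennreal A"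
      using uA by (intro mult_left_mono) auto
    finally show "weighted_integral m (\<lambda>_. 1) u \<le> ennreal (B powr (m - q) * A)"
      using A by (simp add: ennreal_mult)
  qed (use A B in auto)
qed

lemma M_seminorm_Lebesgue_bound:
  assumes p: "1 \<le> p" and s: "0 < s" and sp: "of_nat CARD('n) \<le> ennreal s * p"
    and q: "1 \<le> q" "q \<le> m" and A: "0 < A"
  shows "\<exists>C>0. \<forall>u \<in> borel_measurable lebesgue. weighted_integral q (\<lambda>_. 1) (u :: real ^ 'n \<Rightarrow> real) \<le> ennreal A \<longrightarrow>
    M_seminorm_integral s p u \<le> ennreal A \<longrightarrow> weighted_integral m (\<lambda>_. 1) u \<le> ennreal C"
proof (cases p)
  case (real P)
  then have "1 \<le> P"
    using p by simp
  moreover have "ennreal (real CARD('n)) \<le> ennreal (s * P)"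
    using sp s real by (simp add: ennreal_mult ennreal_of_nat_eq_real_of_nat)
  then have "real CARD('n) \<le> s * P"
    using s \<open>1 \<le> P\<close> by (subst (asm) ennreal_le_iff) auto
  ultimately show ?thesis
    using gagliardo_Lebesgue_bound[of P s q m A] q A real by (simp add: M_seminorm_integral_def)
next
  case top
  then show ?thesis
    using holder_Lebesgue_bound[OF s q A] by (simp add: M_seminorm_integral_def)
qed

subsection \<open>Local smallness in measure\<close>

text \<open>Since q \<ge> 1, |u| \<le> 1 + |u|^q pointwise; the ball has finite measure, which takes
  care of the constant.\<close>

lemma ball_integral_bound:
  fixes u :: "real ^ 'n \<Rightarrow> real"
  assumes [measurable]: "u \<in> borel_measurable lebesgue" and q: "1 \<le> q" and A: "0 \<le> A"
    and le: "weighted_integral q (\<lambda>_. 1) u \<le> ennreal A"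
  shows "set_integrable lebesgue (ball c h) u"
    and "\<bar>set_lebesgue_integral lebesgue (ball c h) u\<bar> \<le> measure lebesgue (ball c h) + A"
proof -
  have "(\<integral>\<^sup>+x. ennreal (norm (indicat_real (ball c h) x *\<^sub>R u x)) \<partial>lebesgue)
      \<le> (\<integral>\<^sup>+x. indicator (ball c h) x + ennreal (\<bar>u x\<bar> powr q * 1) \<partial>lebesgue)"
  proof (rule nn_integral_mono)
    fix x
    have "\<bar>u x\<bar> \<le> 1 + \<bar>u x\<bar> powr q"
      using powr_mono[of 1 q "\<bar>u x\<bar>"] q by (cases "\<bar>u x\<bar> \<le> 1") (auto simp: add_increasing2)
    then show "ennreal (norm (indicat_real (ball c h) x *\<^sub>R u x))
        \<le> indicator (ball c h) x + ennreal (\<bar>u x\<bar> powr q * 1)"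
      by (auto split: split_indicator simp: ennreal_leI simp flip: ennreal_plus ennreal_1)
  qed
  also have "\<dots> = emeasure lebesgue (ball c h) + weighted_integral q (\<lambda>_. 1) u"
    unfolding weighted_integral_def by (subst nn_integral_add) (auto intro!: borel_measurable_indicator)
  also have "\<dots> \<le> ennreal (measure lebesgue (ball c h)) + ennreal A"
    using le emeasure_lborel_ball_finite[of c h] by (intro add_mono) (auto simp: emeasure_eq_ennreal_measure)
  finally have *: "(\<integral>\<^sup>+x. ennreal (norm (indicat_real (ball c h) x *\<^sub>R u x)) \<partial>lebesgue)
      \<le> ennreal (measure lebesgue (ball c h) + A)"
    using A by simp
  show int: "set_integrable lebesgue (ball c h) u"
    unfolding set_integrable_def
    by (rule integrableI_bounded) (use * in \<open>auto simp: le_less_trans intro!: borel_measurable_times borel_measurable_indicator\<close>)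
  have "ennreal (norm (set_lebesgue_integral lebesgue (ball c h) u)) \<le> ennreal (measure lebesgue (ball c h) + A)"
    unfolding set_lebesgue_integral_def
    by (rule order_trans[OF integral_norm_bound_ennreal *]) (use int in \<open>simp add: set_integrable_def\<close>)
  then show "\<bar>set_lebesgue_integral lebesgue (ball c h) u\<bar> \<le> measure lebesgue (ball c h) + A"
    using A by (subst (asm) ennreal_le_iff) auto
qed

text \<open>The mean over the ball of \<open>u x - u y\<close> in \<open>y\<close> is
  \<open>u x\<close> minus the mean of \<open>u\<close>, and the latter is at most \<open>e\<close>
  in absolute value.\<close>

lemma ball_deviation_lower_bound:
  fixes u :: "real ^ 'n \<Rightarrow> real"
  assumes int: "set_integrable lebesgue (ball c h) u"
    and small: "\<bar>set_lebesgue_integral lebesgue (ball c h) u\<bar> \<le> e * measure lebesgue (ball c h)"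
  shows "ennreal ((\<bar>u x\<bar> - e) * measure lebesgue (ball c h))
    \<le> (\<integral>\<^sup>+y. ennreal \<bar>u x - u y\<bar> * indicator (ball c h) y \<partial>lebesgue)"
proof -
  let ?B = "ball c h"
  have const: "set_integrable lebesgue ?B (\<lambda>y. u x)"
    unfolding set_integrable_def using emeasure_lborel_ball_finite[of c h]
    by (intro integrable_scaleR_left integrable_real_indicator) auto
  have diff: "set_integrable lebesgue ?B (\<lambda>y. u x - u y)"
    by (intro set_integral_diff const int)
  have "set_lebesgue_integral lebesgue ?B (\<lambda>y. u x) = u x * measure lebesgue ?B"
    unfolding set_lebesgue_integral_def by simp
  then have "set_lebesgue_integral lebesgue ?B (\<lambda>y. u x - u y) = u x * measure lebesgue ?B
      - set_lebesgue_integral lebesgue ?B u"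
    using set_integral_diff(2)[OF const int] by simp
  then have "\<bar>u x * measure lebesgue ?B\<bar>
      \<le> \<bar>set_lebesgue_integral lebesgue ?B (\<lambda>y. u x - u y)\<bar> + e * measure lebesgue ?B"
    using small by linarith
  then have "(\<bar>u x\<bar> - e) * measure lebesgue ?B \<le> \<bar>set_lebesgue_integral lebesgue ?B (\<lambda>y. u x - u y)\<bar>"
    by (simp add: abs_mult left_diff_distrib)
  then have "ennreal ((\<bar>u x\<bar> - e) * measure lebesgue ?B)
      \<le> ennreal (norm (set_lebesgue_integral lebesgue ?B (\<lambda>y. u x - u y)))"
    by (simp add: ennreal_leI)
  also have "\<dots> \<le> (\<integral>\<^sup>+y. ennreal (norm (indicat_real ?B y *\<^sub>R (u x - u y))) \<partial>lebesgue)"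
    unfolding set_lebesgue_integral_def
    by (rule integral_norm_bound_ennreal) (use diff in \<open>simp add: set_integrable_def\<close>)
  also have "\<dots> = (\<integral>\<^sup>+y. ennreal \<bar>u x - u y\<bar> * indicator ?B y \<partial>lebesgue)"
    by (intro nn_integral_cong) (auto split: split_indicator)
  finally show ?thesis .
qed

text \<open>The total deviation of \<open>u x\<close> from \<open>u y\<close> over the ball is at
  least 2e times its volume. Points \<open>y\<close> with deviation at most \<open>e\<close> account
  for at most half of this; at the others the deviation is dominated by a multiple of the Gagliardo
  integrand.\<close>

lemma gagliardo_inner_lower_bound:
  fixes u :: "real ^ 'n \<Rightarrow> real"
  assumes [measurable]: "u \<in> borel_measurable lebesgue"
    and p: "1 \<le> p" and b: "0 \<le> b" and h: "0 < h" and e: "0 < e" and x: "x \<in> ball c h"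
    and int: "set_integrable lebesgue (ball c h) u"
    and small: "\<bar>set_lebesgue_integral lebesgue (ball c h) u\<bar> \<le> e * measure lebesgue (ball c h)"
    and large: "3 * e < \<bar>u x\<bar>"
  shows "ennreal (e powr p * measure lebesgue (ball c h) / (2 * h) powr b)
    \<le> (\<integral>\<^sup>+y. ennreal (\<bar>u x - u y\<bar> powr p / norm (x - y) powr b) \<partial>lebesgue)" (is "_ \<le> ?g")
proof -
  let ?B = "ball c h"
  have [measurable]: "(\<lambda>y. norm (x - y)) \<in> borel_measurable lebesgue" "?B \<in> sets lebesgue"
    by (auto intro!: measurable_completion)
  have gm: "(\<lambda>y. ennreal (\<bar>u x - u y\<bar> powr p / norm (x - y) powr b)) \<in> borel_measurable lebesgue"
    by measurable
  define \<mu> where "\<mu> = measure lebesgue ?B"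
  have \<mu>: "emeasure lebesgue ?B = ennreal \<mu>" "0 \<le> \<mu>"
    using emeasure_lborel_ball_finite[of c h] by (auto simp: \<mu>_def emeasure_eq_ennreal_measure)
  \<comment> \<open>For D > e one has D \<le> e^(1-p) D^p because p \<ge> 1, and two points of the
    ball are at distance at most 2h. The product of the two losses is \<open>k\<close>.\<close>
  define k where "k = e powr (1 - p) * (2 * h) powr b"
  have k: "0 < k" using e h by (simp add: k_def)
  have "ennreal (2 * e * \<mu>) \<le> ennreal ((\<bar>u x\<bar> - e) * \<mu>)"
    using large \<mu> by (intro ennreal_leI mult_right_mono) auto
  also have "\<dots> \<le> (\<integral>\<^sup>+y. ennreal \<bar>u x - u y\<bar> * indicator ?B y \<partial>lebesgue)"
    unfolding \<mu>_def by (rule ball_deviation_lower_bound[OF int small])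
  also have "\<dots> \<le> (\<integral>\<^sup>+y. ennreal e * indicator ?B y
      + ennreal k * ennreal (\<bar>u x - u y\<bar> powr p / norm (x - y) powr b) \<partial>lebesgue)"
  proof (rule nn_integral_mono)
    fix y
    define D where "D = \<bar>u x - u y\<bar>"
    have "D \<le> e + k * (D powr p / norm (x - y) powr b)" if y: "y \<in> ?B"
    proof (cases "D \<le> e")
      case True
      then show ?thesis using k by (simp add: add_increasing2)
    next
      case False
      then have xy: "x \<noteq> y" using e by (auto simp: D_def)
      have n: "norm (x - y) \<le> 2 * h"
        using x y dist_triangle_less_add[of x c h y h] by (simp add: dist_norm norm_minus_commute)
      have "D = e powr (1 - p) * (e powr (p - 1) * D)"
        using e by (simp flip: powr_add mult.assoc)
      also have "\<dots> \<le> e powr (1 - p) * (D powr (p - 1) * D powr 1)"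
        using False e p by (intro mult_left_mono mult_mono powr_mono2) auto
      also have "\<dots> = e powr (1 - p) * D powr p * 1"
        by (simp only: powr_add[symmetric] mult_1_right mult.assoc) simp
      also have "\<dots> \<le> e powr (1 - p) * D powr p * ((2 * h) powr b / norm (x - y) powr b)"
        using n b xy by (intro mult_left_mono) (auto simp: powr_mono2)
      finally have "D \<le> k * (D powr p / norm (x - y) powr b)"
        by (simp add: k_def mult_ac)
      with e show ?thesis by simp
    qed
    then show "ennreal D * indicator ?B y \<le> ennreal e * indicator ?B y
        + ennreal k * ennreal (D powr p / norm (x - y) powr b)"
      using e k by (auto split: split_indicator simp: ennreal_leI simp flip: ennreal_mult ennreal_plus)
  qed
  also have "\<dots> = ennreal e * emeasure lebesgue ?B + ennreal k * ?g"
    by (simp add: nn_integral_add nn_integral_cmult gm nn_integral_cmult_indicator)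
  also have "ennreal e * emeasure lebesgue ?B = ennreal (e * \<mu>)"
    unfolding \<mu>(1) using e \<mu>(2) by (simp add: ennreal_mult)
  also have "ennreal (2 * e * \<mu>) = ennreal (e * \<mu>) + ennreal (e * \<mu>)"
    using e \<mu>(2) by (subst ennreal_plus[symmetric]) auto
  \<comment> \<open>One of the two copies of e times the volume cancels against the contribution of
    the small deviations.\<close>
  finally have *: "ennreal (e * \<mu>) \<le> ennreal k * ?g"
    by (simp add: ennreal_add_left_cancel_le)
  have "e powr p * \<mu> / (2 * h) powr b = 1 / k * (e * \<mu>)"
    using e h by (simp add: k_def powr_diff field_simps)
  then have "ennreal (e powr p * \<mu> / (2 * h) powr b) = ennreal (1 / k) * ennreal (e * \<mu>)"
    using e k \<mu>(2) by (simp flip: ennreal_mult)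
  also have "\<dots> \<le> ennreal (1 / k) * (ennreal k * ?g)"
    using * by (rule mult_left_mono) simp
  also have "\<dots> = ?g"
    using k by (simp flip: ennreal_mult mult.assoc)
  finally show ?thesis
    by (simp add: \<mu>_def)
qed

text \<open>The lower bound for the inner integral holds at each point of the exceptional set,
  whichever ball contains it. It is integrated over the union and not summed over the balls, so the
  result does not depend on their number \<open>I\<close>.\<close>

lemma gagliardo_measure_bound:
  fixes u :: "real ^ 'n \<Rightarrow> real" and d :: "nat \<Rightarrow> real ^ 'n" and s p :: real
  assumes u[measurable]: "u \<in> borel_measurable lebesgue"
    and p: "1 \<le> p" and s: "0 < s" and h: "0 < h" and e: "0 < e" and A: "0 < A"
    and G: "gagliardo_integral s p u \<le> ennreal A"
    and int: "\<And>c. set_integrable lebesgue (ball c h) u"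
    and small: "\<And>i. i < I \<Longrightarrow> \<bar>set_lebesgue_integral lebesgue (ball (d i) h) u\<bar>
      \<le> e * (unit_ball_vol CARD('n) * h ^ CARD('n))"
  shows "emeasure lebesgue ((\<Union>i<I. ball (d i) h) \<inter> {x. 3 * e < \<bar>u x\<bar>})
    \<le> ennreal (A * 2 powr (CARD('n) + s * p) / (e powr p * unit_ball_vol CARD('n)) * h powr (s * p))"
proof -
  define n where "n = real CARD('n)"
  define v where "v = unit_ball_vol n"
  have n: "0 < n" "0 < v" by (auto simp: n_def v_def)
  define \<mu> where "\<mu> = v * h ^ CARD('n)"
  have \<mu>: "measure lebesgue (ball c h) = \<mu>" for c :: "real ^ 'n"
    using h by (simp add: \<mu>_def v_def n_def content_ball)
  define b where "b = n + s * p"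
  define D where "D = (\<Union>i<I. ball (d i) h) \<inter> {x. 3 * e < \<bar>u x\<bar>}"
  define k where "k = e powr p * \<mu> / (2 * h) powr b"
  have k: "0 < k" using e h n by (simp add: k_def \<mu>_def)
  have D[measurable]: "D \<in> sets lebesgue"
    unfolding D_def by (intro sets.Int sets.finite_UN) auto
  have "ennreal k * emeasure lebesgue D = (\<integral>\<^sup>+x. ennreal k * indicator D x \<partial>lebesgue)"
    by (subst nn_integral_cmult_indicator) auto
  also have "\<dots> \<le> gagliardo_integral s p u"
    unfolding gagliardo_integral_def
  proof (rule nn_integral_mono)
    fix x
    show "ennreal k * indicator D x
      \<le> (\<integral>\<^sup>+y. ennreal (\<bar>u x - u y\<bar> powr p / norm (x - y) powr (real CARD('n) + s * p)) \<partial>lebesgue)"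
    proof (cases "x \<in> D")
      case True
      then obtain i where i: "i < I" "x \<in> ball (d i) h" "3 * e < \<bar>u x\<bar>"
        by (auto simp: D_def)
      have "0 \<le> real CARD('n) + s * p" using s p by simp
      moreover have "\<bar>set_lebesgue_integral lebesgue (ball (d i) h) u\<bar> \<le> e * measure lebesgue (ball (d i) h)"
        using small[OF i(1)] unfolding \<mu> by (simp add: \<mu>_def v_def n_def)
      ultimately show ?thesis
        using gagliardo_inner_lower_bound[OF u p _ h e i(2) int _ i(3)] True
        unfolding \<mu> by (simp add: k_def b_def n_def)
    qed simp
  qed
  also have "\<dots> \<le> ennreal A" by (rule G)
  finally have "emeasure lebesgue D \<le> ennreal (A / k)"
    using k A by (intro le_divide_ennrealI) auto
  \<comment> \<open>The h^n from the volume of a ball cancels the h^n in (2h)^(n + sp). The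
    surviving power h^(sp) is what tends to 0 with the radius.\<close>
  also have "A / k = A * 2 powr b / (e powr p * v) * h powr (s * p)"
  proof -
    have "(2 * h) powr b = 2 powr b * (h powr n * h powr (s * p))"
      using h by (simp add: powr_mult b_def powr_add)
    also have "h powr n = h ^ CARD('n)"
      using h by (simp add: n_def powr_realpow)
    finally show ?thesis
      using h e n by (simp add: k_def \<mu>_def field_simps)
  qed
  finally show ?thesis
    by (simp add: D_def n_def v_def b_def)
qed

text \<open>The counterpart for p = \<infinity>: the oscillation on the ball is at most A (2h)^s
  \<le> e, so |u x| exceeds the absolute mean by at most \<open>e\<close>.\<close>

lemma holder_small_means:
  fixes u :: "real ^ 'n \<Rightarrow> real"
  assumes H: "holder_seminorm s u \<le> ennreal A" and A: "0 < A" and s: "0 < s" and h: "0 < h"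
    and Ah: "A * (2 * h) powr s \<le> e" and x: "x \<in> ball c h"
    and int: "set_integrable lebesgue (ball c h) u"
    and small: "\<bar>set_lebesgue_integral lebesgue (ball c h) u\<bar> \<le> e * measure lebesgue (ball c h)"
  shows "\<bar>u x\<bar> \<le> 2 * e"
proof -
  let ?B = "ball c h"
  have e: "0 < e"
    using A h Ah by (smt (verit) mult_pos_pos powr_gt_zero)
  have "ennreal ((\<bar>u x\<bar> - e) * measure lebesgue ?B) \<le> (\<integral>\<^sup>+y. ennreal \<bar>u x - u y\<bar> * indicator ?B y \<partial>lebesgue)"
    by (rule ball_deviation_lower_bound[OF int small])
  also have "\<dots> \<le> (\<integral>\<^sup>+y. ennreal e * indicator ?B y \<partial>lebesgue)"
  proof (rule nn_integral_mono)
    fix y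
    have "\<bar>u x - u y\<bar> \<le> e" if y: "y \<in> ?B"
    proof -
      have n: "norm (x - y) \<le> 2 * h"
        using x y dist_triangle_less_add[of x c h y h] by (simp add: dist_norm norm_minus_commute)
      have "\<bar>u x - u y\<bar> \<le> A * norm (x - y) powr s"
        using H A by (simp add: holder_seminorm_le_iff)
      also have "\<dots> \<le> A * (2 * h) powr s"
        using n A s by (intro mult_left_mono powr_mono2) auto
      finally show ?thesis using Ah by simp
    qed
    then show "ennreal \<bar>u x - u y\<bar> * indicator ?B y \<le> ennreal e * indicator ?B y"
      by (auto split: split_indicator intro: ennreal_leI)
  qed
  also have "\<dots> = ennreal e * emeasure lebesgue ?B"
    by (subst nn_integral_cmult_indicator) auto
  also have "emeasure lebesgue ?B = ennreal (measure lebesgue ?B)"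
    using emeasure_lborel_ball_finite[of c h] by (auto simp: emeasure_eq_ennreal_measure)
  finally have "ennreal ((\<bar>u x\<bar> - e) * measure lebesgue ?B) \<le> ennreal (e * measure lebesgue ?B)"
    using e by (simp add: ennreal_mult)
  then have "(\<bar>u x\<bar> - e) * measure lebesgue ?B \<le> e * measure lebesgue ?B"
    using e by (subst (asm) ennreal_le_iff) auto
  moreover have "0 < measure lebesgue ?B"
    using h by (simp add: content_ball_pos)
  ultimately show ?thesis
    by simp
qed

text \<open>The radius comes first and depends only on the bounds: it makes the exceptional part of
  any finite union of balls have measure at most \<eta>/2. Then finitely many balls of this radius
  are taken that cover \<Omega> up to measure \<eta>/2. This order works because the first estimate
  is independent of the number of balls.\<close>

lemma small_means_imp_small_measure:
  fixes d :: "nat \<Rightarrow> real ^ 'n"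
  assumes dense: "\<And>x r. 0 < r \<Longrightarrow> \<exists>i. x \<in> ball (d i) r"
    and p: "1 \<le> p" and s: "0 < s" and q: "1 \<le> q" and A: "0 < A" and e: "0 < e" and \<eta>: "0 < \<eta>"
    and \<Omega>[measurable]: "\<Omega> \<in> sets lebesgue" and fin: "emeasure lebesgue \<Omega> < \<infinity>"
  shows "\<exists>j I. \<exists>\<delta>>0. \<forall>u \<in> borel_measurable lebesgue. weighted_integral q (\<lambda>_. 1) u \<le> ennreal A \<longrightarrow>
    M_seminorm_integral s p u \<le> ennreal A \<longrightarrow>
    (\<forall>i<I. \<bar>set_lebesgue_integral lebesgue (ball (d i) (1 / real (Suc j))) u\<bar> \<le> \<delta>) \<longrightarrow>
    emeasure lebesgue (\<Omega> \<inter> {x. 3 * e < \<bar>u x\<bar>}) \<le> ennreal \<eta>"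
proof -
  define n where "n = real CARD('n)"
  define v where "v = unit_ball_vol n"
  have n: "0 < n" "0 < v" by (auto simp: n_def v_def)
  define P where "P = enn2real p"
  define \<alpha> where "\<alpha> = (if p = \<infinity> then s else s * P)"
  have P: "p \<noteq> \<infinity> \<Longrightarrow> 1 \<le> P" using p by (auto simp: P_def enn2real_ge_1)
  then have \<alpha>: "0 < \<alpha>" using s by (auto simp: \<alpha>_def)
  define C where "C = A * 2 powr (n + s * P) / (e powr P * v)"
  define h where "h j = 1 / real (Suc j)" for j
  have h: "0 < h j" for j by (simp add: h_def)
  have hlim: "h \<longlonglongrightarrow> 0"
    unfolding h_def by (rule LIMSEQ_Suc[OF lim_1_over_n])
  have "(\<lambda>j. C * h j powr (s * P)) \<longlonglongrightarrow> C * 0 powr (s * P)" if "p \<noteq> \<infinity>"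
    using s P[OF that] h by (intro tendsto_mult tendsto_const tendsto_powr' hlim) (auto simp: less_imp_le)
  then have ev1: "p \<noteq> \<infinity> \<Longrightarrow> eventually (\<lambda>j. C * h j powr (s * P) < \<eta> / 2) sequentially"
    using \<eta> by (auto dest!: order_tendstoD(2)[of _ _ _ "\<eta> / 2"])
  have "(\<lambda>j. A * (2 * h j) powr s) \<longlonglongrightarrow> A * (2 * 0) powr s"
    using s h by (intro tendsto_mult tendsto_const tendsto_powr' hlim) (auto simp: less_imp_le)
  then have ev2: "eventually (\<lambda>j. A * (2 * h j) powr s < e) sequentially"
    using e by (auto dest!: order_tendstoD(2)[of _ _ _ e])
  obtain j where j: "p \<noteq> \<infinity> \<Longrightarrow> C * h j powr (s * P) < \<eta> / 2" "A * (2 * h j) powr s < e"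
    using ev1 ev2 unfolding eventually_sequentially by (metis nle_le)
  define D where "D I = \<Omega> - (\<Union>i<I. ball (d i) (h j))" for I :: nat
  have [measurable]: "(\<Union>i<I. ball (d i) (h j)) \<in> sets lebesgue" for I :: nat
    by (intro sets.finite_UN) auto
  have Dm[measurable]: "D I \<in> sets lebesgue" for I
    unfolding D_def by measurable
  \<comment> \<open>Continuity from above, available because \<Omega> has finite measure. Density of
    the centres makes the uncovered parts decrease to the empty set.\<close>
  have "(\<lambda>I. emeasure lebesgue (D I)) \<longlonglongrightarrow> emeasure lebesgue (\<Inter>I. D I)"
  proof (rule Lim_emeasure_decseq)
    show "decseq D" unfolding decseq_def D_def by (auto dest: less_le_trans)
    have "emeasure lebesgue (D I) \<le> emeasure lebesgue \<Omega>" for I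
      by (intro emeasure_mono) (auto simp: D_def)
    then show "emeasure lebesgue (D I) \<noteq> \<infinity>" for I
      using fin by (metis infinity_ennreal_def leD top.not_eq_extremum)
  qed auto
  also have "(\<Inter>I. D I) = {}"
  proof -
    have "\<exists>I. x \<notin> D I" for x
      using dense[OF h, of x j] unfolding D_def by blast
    then show ?thesis by blast
  qed
  finally have "(\<lambda>I. emeasure lebesgue (D I)) \<longlonglongrightarrow> 0" by simp
  then have "eventually (\<lambda>I. emeasure lebesgue (D I) < ennreal (\<eta> / 2)) sequentially"
    using \<eta> by (intro order_tendstoD) auto
  then obtain I where I: "emeasure lebesgue (D I) < ennreal (\<eta> / 2)"
    by (auto simp: eventually_sequentially)
  define \<mu> where "\<mu> = v * h j ^ CARD('n)"
  have \<mu>: "measure lebesgue (ball c (h j)) = \<mu>" for c :: "real ^ 'n"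
    using h[of j] by (simp add: \<mu>_def v_def n_def content_ball)
  have \<mu>0: "0 < \<mu>" using n h[of j] by (simp add: \<mu>_def)
  show ?thesis
  \<comment> \<open>All balls of radius \<open>h j\<close> have volume \<mu>, so the threshold
    \<open>e * \<mu>\<close> for the integrals says that the means are at most
    \<open>e\<close>.\<close>
  proof (rule exI[of _ j], rule exI[of _ I], rule exI[of _ "e * \<mu>"], intro conjI ballI impI)
    fix u :: "real ^ 'n \<Rightarrow> real"
    assume u[measurable]: "u \<in> borel_measurable lebesgue"
      and uA: "weighted_integral q (\<lambda>_. 1) u \<le> ennreal A" and G: "M_seminorm_integral s p u \<le> ennreal A"
      and small: "\<forall>i<I. \<bar>set_lebesgue_integral lebesgue (ball (d i) (1 / real (Suc j))) u\<bar> \<le> e * \<mu>"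
    define E where "E = (\<Union>i<I. ball (d i) (h j)) \<inter> {x. 3 * e < \<bar>u x\<bar>}"
    have Em[measurable]: "E \<in> sets lebesgue" unfolding E_def by measurable
    have int: "set_integrable lebesgue (ball c (h j)) u" for c
      using ball_integral_bound(1)[OF u q _ uA] A by simp
    have E: "emeasure lebesgue E \<le> ennreal (\<eta> / 2)"
    proof (cases "p = \<infinity>")
      case True
      have "\<bar>u x\<bar> \<le> 2 * e" if "i < I" "x \<in> ball (d i) (h j)" for x i
      proof (rule holder_small_means[OF _ A s h _ that(2) int])
        show "holder_seminorm s u \<le> ennreal A"
          using G True by (simp add: M_seminorm_integral_def)
        show "\<bar>set_lebesgue_integral lebesgue (ball (d i) (h j)) u\<bar> \<le> e * measure lebesgue (ball (d i) (h j))"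
          using small that(1) unfolding \<mu> by (simp add: h_def)
      qed (use j(2) in simp)
      \<comment> \<open>On the chosen balls |u| is at most 2e, which is below the level 3e.\<close>
      then have "E = {}"
        using e by (force simp: E_def)
      then show ?thesis by simp
    next
      case False
      have "emeasure lebesgue E \<le> ennreal (C * h j powr (s * P))"
        unfolding E_def C_def v_def n_def
        using u P[OF False] s h[of j] e A G False int small
        by (intro gagliardo_measure_bound) (auto simp: M_seminorm_integral_def P_def h_def \<mu>_def v_def n_def)
      also have "\<dots> \<le> ennreal (\<eta> / 2)"
        using j(1)[OF False] by (intro ennreal_leI) simp
      finally show ?thesis .
    qed
    have "emeasure lebesgue (\<Omega> \<inter> {x. 3 * e < \<bar>u x\<bar>}) \<le> emeasure lebesgue (E \<union> D I)"
      by (intro emeasure_mono) (auto simp: E_def D_def)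
    also have "\<dots> \<le> emeasure lebesgue E + emeasure lebesgue (D I)"
      by (intro emeasure_subadditive) auto
    also have "\<dots> \<le> ennreal (\<eta> / 2) + ennreal (\<eta> / 2)"
      using E I by (intro add_mono) auto
    also have "\<dots> = ennreal \<eta>"
      using \<eta> by (simp flip: ennreal_plus)
    finally show "emeasure lebesgue (\<Omega> \<inter> {x. 3 * e < \<bar>u x\<bar>}) \<le> ennreal \<eta>" .
  qed (use e \<mu>0 in simp)
qed

subsection \<open>The weights\<close>

text \<open>Young's inequality for \<nu>^(1/T) a and \<nu>^(-1/T) b, with the factors 1/T and
  (T-1)/T estimated by 1. The free \<nu> makes the first term as small as desired at the expense of
  the second.\<close>

lemma Youngs_inequality_scaled:
  fixes a b T \<nu> :: real
  assumes T: "1 < T" and \<nu>: "0 < \<nu>" and ab: "0 \<le> a" "0 \<le> b"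
  shows "a * b \<le> \<nu> * a powr T + \<nu> powr (- 1 / (T - 1)) * b powr (T / (T - 1))"
proof -
  define c where "c = \<nu> powr (1 / T)"
  have c: "0 < c" using \<nu> by (simp add: c_def)
  have T': "1 < T / (T - 1)" "1 / T + 1 / (T / (T - 1)) = 1"
    using T by (auto simp: field_simps)
  have div_le: "x / y \<le> x" if "1 < y" "0 \<le> x" for x y :: real
    using that by (simp add: divide_le_eq mult_le_cancel_left1)
  have "a * b = (c * a) * (b / c)"
    using c by simp
  also have "\<dots> \<le> (c * a) powr T / T + (b / c) powr (T / (T - 1)) / (T / (T - 1))"
    using T T' ab c by (intro Youngs_inequality) auto
  also have "\<dots> \<le> (c * a) powr T + (b / c) powr (T / (T - 1))"
    using T T' by (intro add_mono div_le) auto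
  also have "(c * a) powr T = \<nu> * a powr T"
    using T \<nu> ab by (simp add: c_def powr_mult powr_powr)
  also have "(b / c) powr (T / (T - 1)) = \<nu> powr (- 1 / (T - 1)) * b powr (T / (T - 1))"
  proof -
    have "(b / c) powr (T / (T - 1)) = b powr (T / (T - 1)) / \<nu> powr (1 / T * (T / (T - 1)))"
      using ab c by (simp add: powr_divide c_def powr_powr)
    also have "1 / T * (T / (T - 1)) = 1 / (T - 1)"
      using T by simp
    finally show ?thesis
      by (simp add: powr_minus field_simps flip: minus_divide_left)
  qed
  finally show ?thesis .
qed

text \<open>Both bases are at most \<open>max a b\<close>, and the exponents add up to 1.\<close>

lemma powr_interpolate_le:
  fixes a b \<tau> :: real
  assumes "0 \<le> a" "0 \<le> b" "0 < \<tau>" "\<tau> < 1"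
  shows "a powr \<tau> * b powr (1 - \<tau>) \<le> a + b"
proof -
  have "a powr \<tau> * b powr (1 - \<tau>) \<le> max a b powr \<tau> * max a b powr (1 - \<tau>)"
    using assms by (intro mult_mono powr_mono2) auto
  also have "\<dots> = max a b"
    using assms by (simp flip: powr_add)
  finally show ?thesis
    using assms by linarith
qed

text \<open>For t = \<infinity> the exponent 2 serves, as an essentially bounded function on a set
  of finite measure is square integrable. A finite \<open>T\<close> above 1 has a conjugate exponent
  T/(T-1) to which Young's inequality applies.\<close>

lemma Lp_on_finite_exponent:
  fixes K :: "real ^ 'n \<Rightarrow> real"
  assumes t: "1 < t" and K: "\<And>x. 0 < K x"
    and Lp: "\<And>\<Omega>. \<Omega> \<in> sets lebesgue \<Longrightarrow> emeasure lebesgue \<Omega> < \<infinity> \<Longrightarrow> Lp_on t \<Omega> K"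
  obtains T :: real where "1 < T" "\<And>\<Omega>. \<Omega> \<in> sets lebesgue \<Longrightarrow> emeasure lebesgue \<Omega> < \<infinity> \<Longrightarrow>
    (\<integral>\<^sup>+x\<in>\<Omega>. ennreal (K x powr T) \<partial>lebesgue) < \<infinity>"
proof (cases t)
  case (real T)
  show thesis
  proof (rule that[of T])
    show "1 < T" using t real by simp
    show "(\<integral>\<^sup>+x\<in>\<Omega>. ennreal (K x powr T) \<partial>lebesgue) < \<infinity>"
      if "\<Omega> \<in> sets lebesgue" "emeasure lebesgue \<Omega> < \<infinity>" for \<Omega>
      using Lp[OF that] real K by (simp add: Lp_on_def less_imp_le)
  qed
next
  case top
  show thesis
  proof (rule that[of 2])
    show "(\<integral>\<^sup>+x\<in>\<Omega>. ennreal (K x powr 2) \<partial>lebesgue) < \<infinity>"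
      if \<Omega>: "\<Omega> \<in> sets lebesgue" "emeasure lebesgue \<Omega> < \<infinity>" for \<Omega>
    proof -
      obtain C where C: "AE x\<in>\<Omega> in lebesgue. \<bar>K x\<bar> \<le> C"
        using Lp[OF \<Omega>] top by (auto simp: Lp_on_def)
      have "(\<integral>\<^sup>+x\<in>\<Omega>. ennreal (K x powr 2) \<partial>lebesgue) \<le> (\<integral>\<^sup>+x. ennreal (C powr 2) * indicator \<Omega> x \<partial>lebesgue)"
      proof (rule nn_integral_mono_AE)
        show "AE x in lebesgue. ennreal (K x powr 2) * indicator \<Omega> x \<le> ennreal (C powr 2) * indicator \<Omega> x"
          using C
        proof eventually_elim
          case (elim x)
          then show ?case
            using K[of x] by (auto split: split_indicator intro!: ennreal_leI powr_mono2)
        qed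
      qed
      also have "\<dots> = ennreal (C powr 2) * emeasure lebesgue \<Omega>"
        using \<Omega> by (subst nn_integral_cmult_indicator) auto
      also have "\<dots> < \<infinity>"
        using \<Omega>(2) by (simp add: ennreal_mult_less_top)
      finally show ?thesis .
    qed
  qed simp
qed

lemma weight_tail:
  fixes K V :: "real ^ 'n \<Rightarrow> real" and \<tau> e :: real
  assumes [measurable]: "K \<in> borel_measurable lebesgue" "V \<in> borel_measurable lebesgue"
    and K: "\<And>x. 0 < K x" and V: "\<And>x. 0 < V x"
    and van: "vanishes_at_infinity (\<lambda>x. K x * V x powr (- \<tau>))" and e: "0 < e"
  shows "\<exists>\<Omega>\<in>sets lebesgue. emeasure lebesgue \<Omega> < \<infinity> \<and> (\<forall>x. x \<notin> \<Omega> \<longrightarrow> K x \<le> e * V x powr \<tau>)"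
proof (intro bexI conjI allI impI)
  let ?\<Omega> = "{x. e \<le> \<bar>K x * V x powr (- \<tau>)\<bar>}"
  show "emeasure lebesgue ?\<Omega> < \<infinity>"
    using van e by (simp add: vanishes_at_infinity_def)
  have "{x\<in>space lebesgue. e \<le> \<bar>K x * V x powr (- \<tau>)\<bar>} \<in> sets lebesgue"
    by measurable
  then show "?\<Omega> \<in> sets lebesgue"
    by simp
  fix x assume "x \<notin> ?\<Omega>"
  then have "K x * V x powr (- \<tau>) \<le> e"
    using K[of x] by simp
  then show "K x \<le> e * V x powr \<tau>"
    using V[of x] by (simp add: powr_minus field_simps)
qed

text \<open>Where K \<le> e V^\<tau>, the product z^r K is at most e z^r V^\<tau>. The exponent
  \<open>m\<close> is determined by r = q\<tau> + m(1-\<tau>), so that z^r V^\<tau> = (z^q V)^\<tau>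
  (z^m)^(1-\<tau>) can be interpolated. The set \<Omega> is chosen before \<open>z\<close>, hence
  one set serves all functions at once.\<close>

lemma weight_tail_powr:
  fixes K V :: "real ^ 'n \<Rightarrow> real" and q r e :: real
  assumes KV: "K \<in> borel_measurable lebesgue" "V \<in> borel_measurable lebesgue"
    and K: "\<And>x. 0 < K x" and V: "\<And>x. 0 < V x" and q: "1 \<le> q" "q \<le> r"
    and lt: "q < r \<Longrightarrow> \<exists>\<tau>. 0 < \<tau> \<and> \<tau> < 1 \<and> vanishes_at_infinity (\<lambda>x. K x * V x powr (- \<tau>))"
    and eq: "q = r \<Longrightarrow> vanishes_at_infinity (\<lambda>x. K x * V x powr (- 1))"
  obtains m where "q \<le> m" "\<And>e. 0 < e \<Longrightarrow> \<exists>\<Omega>\<in>sets lebesgue. emeasure lebesgue \<Omega> < \<infinity> \<and>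
    (\<forall>x z. x \<notin> \<Omega> \<longrightarrow> 0 \<le> z \<longrightarrow> z powr r * K x \<le> e * (z powr q * V x + z powr m))"
proof (cases "q = r")
  case True
  show thesis
  \<comment> \<open>For q = r the bound K \<le> e V already gives z^r K \<le> e z^q V; the choice m
    = q only provides the nonnegative extra term.\<close>
  proof (rule that[of q])
    fix e :: real assume e: "0 < e"
    obtain \<Omega> where \<Omega>: "\<Omega> \<in> sets lebesgue" "emeasure lebesgue \<Omega> < \<infinity>"
      and le: "\<And>x. x \<notin> \<Omega> \<Longrightarrow> K x \<le> e * V x powr 1"
      using weight_tail[OF KV K V eq[OF True] e] by blast
    have "z powr r * K x \<le> e * (z powr q * V x + z powr q)" if "x \<notin> \<Omega>" for x z
    proof -
      have "z powr r * K x \<le> z powr r * (e * V x)"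
        using le[OF that] V[of x] by (intro mult_left_mono) auto
      also have "\<dots> \<le> e * (z powr q * V x + z powr q)"
        using True e by (simp add: algebra_simps)
      finally show ?thesis .
    qed
    with \<Omega> show "\<exists>\<Omega>\<in>sets lebesgue. emeasure lebesgue \<Omega> < \<infinity> \<and>
        (\<forall>x z. x \<notin> \<Omega> \<longrightarrow> 0 \<le> z \<longrightarrow> z powr r * K x \<le> e * (z powr q * V x + z powr q))"
      by blast
  qed simp
next
  case False
  with q lt obtain \<tau> where \<tau>: "0 < \<tau>" "\<tau> < 1"
    and van: "vanishes_at_infinity (\<lambda>x. K x * V x powr (- \<tau>))"
    by auto
  define m where "m = (r - q * \<tau>) / (1 - \<tau>)"
  have m: "m * (1 - \<tau>) = r - q * \<tau>"
    using \<tau> by (simp add: m_def)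
  show thesis
  proof (rule that[of m])
    show "q \<le> m"
      using \<tau> q by (simp add: m_def le_divide_eq algebra_simps)
    fix e :: real assume e: "0 < e"
    obtain \<Omega> where \<Omega>: "\<Omega> \<in> sets lebesgue" "emeasure lebesgue \<Omega> < \<infinity>"
      and le: "\<And>x. x \<notin> \<Omega> \<Longrightarrow> K x \<le> e * V x powr \<tau>"
      using weight_tail[OF KV K V van e] by blast
    have "z powr r * K x \<le> e * (z powr q * V x + z powr m)" if "x \<notin> \<Omega>" "0 \<le> z" for x z
    proof -
      have "z powr r * K x \<le> z powr r * (e * V x powr \<tau>)"
        using le[OF that(1)] by (intro mult_left_mono) auto
      also have "\<dots> = z powr (q * \<tau>) * z powr (m * (1 - \<tau>)) * (e * V x powr \<tau>)"
        unfolding m by (simp flip: powr_add)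
      also have "\<dots> = e * ((z powr q * V x) powr \<tau> * (z powr m) powr (1 - \<tau>))"
        using V[of x] by (simp add: powr_mult powr_powr)
      also have "\<dots> \<le> e * (z powr q * V x + z powr m)"
        using e \<tau> V[of x] by (intro mult_left_mono powr_interpolate_le) auto
      finally show ?thesis .
    qed
    with \<Omega> show "\<exists>\<Omega>\<in>sets lebesgue. emeasure lebesgue \<Omega> < \<infinity> \<and>
        (\<forall>x z. x \<notin> \<Omega> \<longrightarrow> 0 \<le> z \<longrightarrow> z powr r * K x \<le> e * (z powr q * V x + z powr m))"
      by blast
  qed
qed

subsection \<open>Homogeneity and completeness\<close>

lemma ennpowr_mult:
  assumes "0 < c" "0 < a"
  shows "ennpowr (ennreal c * x) a = ennreal (c powr a) * ennpowr x a"
  using assms by (cases x) (auto simp: ennpowr_def ennreal_mult_top powr_mult simp flip: ennreal_mult)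

lemma weighted_norm_scale:
  fixes u W :: "real ^ 'n \<Rightarrow> real"
  assumes [measurable]: "u \<in> borel_measurable lebesgue" "W \<in> borel_measurable lebesgue"
    and W: "\<And>x. 0 < W x" and q: "0 < q" and c: "0 < c"
  shows "weighted_norm q W (\<lambda>x. c * u x) = ennreal c * weighted_norm q W u"
proof -
  have "weighted_integral q W (\<lambda>x. c * u x) = (\<integral>\<^sup>+x. ennreal (c powr q) * ennreal (\<bar>u x\<bar> powr q * W x) \<partial>lebesgue)"
    unfolding weighted_integral_def using c W
    by (intro nn_integral_cong) (simp add: abs_mult powr_mult mult.assoc less_imp_le flip: ennreal_mult)
  also have "\<dots> = ennreal (c powr q) * weighted_integral q W u"
    unfolding weighted_integral_def by (intro nn_integral_cmult) measurable
  finally show ?thesis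
    using c q by (simp add: weighted_norm_def ennpowr_mult powr_powr)
qed

lemma gagliardo_integral_scale:
  fixes u :: "real ^ 'n \<Rightarrow> real"
  assumes u: "u \<in> borel_measurable lebesgue" and c: "0 < c"
  shows "gagliardo_integral s p (\<lambda>x. c * u x) = ennreal (c powr p) * gagliardo_integral s p u"
proof -
  \<comment> \<open>A Borel function equal to \<open>u\<close> almost everywhere makes the integrand
    jointly measurable, so constants can be moved out of both iterated integrals.\<close>
  obtain f where f[measurable]: "f \<in> borel_measurable lborel" and uf: "AE x in lborel. u x = f x"
    using completion_ex_borel_measurable_real[OF u] by blast
  define F where "F x y = ennreal (\<bar>f x - f y\<bar> powr p / norm (x - y) powr (real CARD('n) + s * p))" for x y
  have [measurable]: "(\<lambda>(x, y). F x y) \<in> borel_measurable (lborel \<Otimes>\<^sub>M lborel)"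
    unfolding F_def by measurable
  have "AE x in lborel. c * u x = c * f x"
    using uf by eventually_elim simp
  then have "gagliardo_integral s p (\<lambda>x. c * u x) = gagliardo_integral s p (\<lambda>x. c * f x)"
    by (rule gagliardo_integral_cong_AE)
  also have "\<dots> = (\<integral>\<^sup>+x. \<integral>\<^sup>+y. ennreal (c powr p) * F x y \<partial>lborel \<partial>lborel)"
    unfolding gagliardo_integral_lborel F_def using c
    by (intro nn_integral_cong) (simp add: abs_mult powr_mult flip: ennreal_mult right_diff_distrib)
  also have "\<dots> = ennreal (c powr p) * (\<integral>\<^sup>+x. \<integral>\<^sup>+y. F x y \<partial>lborel \<partial>lborel)"
    by (simp add: nn_integral_cmult)
  also have "(\<integral>\<^sup>+x. \<integral>\<^sup>+y. F x y \<partial>lborel \<partial>lborel) = gagliardo_integral s p u"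
    unfolding gagliardo_integral_cong_AE[OF uf] by (simp add: gagliardo_integral_lborel F_def)
  finally show ?thesis .
qed

lemma holder_seminorm_scale_le:
  fixes u :: "real ^ 'n \<Rightarrow> real"
  assumes c: "0 < c"
  shows "holder_seminorm s (\<lambda>x. c * u x) \<le> ennreal c * holder_seminorm s u"
proof (cases "holder_seminorm s u")
  case (real H)
  then have "\<bar>u x - u y\<bar> \<le> H * norm (x - y) powr s" for x y
    using holder_seminorm_le_iff[of H s u] by simp
  then have "c * \<bar>u x - u y\<bar> \<le> c * (H * norm (x - y) powr s)" for x y
    using c by (intro mult_left_mono) auto
  then have "\<bar>c * u x - c * u y\<bar> \<le> (c * H) * norm (x - y) powr s" for x y
    using c by (simp add: abs_mult mult.assoc flip: right_diff_distrib)
  then show ?thesis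
    using real c by (simp add: holder_seminorm_le_iff flip: ennreal_mult)
next
  case top
  then show ?thesis
    using c by (simp add: ennreal_mult_top)
qed

lemma M_norm_scale_le:
  fixes u V :: "real ^ 'n \<Rightarrow> real"
  assumes u: "u \<in> borel_measurable lebesgue" and V: "V \<in> borel_measurable lebesgue" "\<And>x. 0 < V x"
    and q: "1 \<le> q" and p: "1 \<le> p" and c: "0 < c"
  shows "M_norm s q p V (\<lambda>x. c * u x) \<le> ennreal c * M_norm s q p V u"
proof -
  have "gagliardo_seminorm s p (\<lambda>x. c * u x) \<le> ennreal c * gagliardo_seminorm s p u"
  proof (cases "p = \<infinity>")
    case True
    then show ?thesis
      using holder_seminorm_scale_le[OF c] by (simp add: gagliardo_seminorm_def)
  next
    case False
    then have "0 < enn2real p"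
      using enn2real_ge_1[OF p] by simp
    then show ?thesis
      using False c u by (simp add: gagliardo_seminorm_def gagliardo_integral_scale ennpowr_mult powr_powr)
  qed
  then show ?thesis
    using weighted_norm_scale[OF u V, of q c] q c by (simp add: M_norm_def distrib_left add_mono)
qed

text \<open>Taking \<open>q\<close>-th and \<open>p\<close>-th powers turns a norm bound of any size
  into bounds for the integrals, with which all later estimates work.\<close>

lemma M_norm_boundD:
  assumes q: "1 \<le> q" and p: "1 \<le> p" and B: "0 < B"
  shows "\<exists>A>0. \<forall>u :: real ^ 'n \<Rightarrow> real. M_norm s q p V u \<le> ennreal B \<longrightarrow>
    weighted_integral q V u \<le> ennreal A \<and> M_seminorm_integral s p u \<le> ennreal A"
proof -
  define P where "P = enn2real p"
  define C where "C = (if p = \<infinity> then B else B powr P)"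
  have Bq: "(B powr a) powr (1 / a) = B" if "1 \<le> a" for a
    using that B by (simp add: powr_powr)
  show ?thesis
  proof (intro exI[of _ "max (B powr q) C"] conjI allI impI)
    show "0 < max (B powr q) C"
      using B by (simp add: less_max_iff_disj)
    fix u :: "real ^ 'n \<Rightarrow> real"
    assume "M_norm s q p V u \<le> ennreal B"
    moreover have "weighted_norm q V u \<le> M_norm s q p V u" "gagliardo_seminorm s p u \<le> M_norm s q p V u"
      by (simp_all add: M_norm_def)
    ultimately have a: "weighted_norm q V u \<le> ennreal B" and b: "gagliardo_seminorm s p u \<le> ennreal B"
      using order_trans by blast+
    have "weighted_integral q V u \<le> ennreal (B powr q)"
      using a B q Bq[of q] by (intro le_ennpowr[of "1 / q" "B powr q"]) (simp_all add: weighted_norm_def)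
    then show "weighted_integral q V u \<le> ennreal (max (B powr q) C)"
      by (rule order_trans) (intro ennreal_leI, simp)
    have "M_seminorm_integral s p u \<le> ennreal C"
    proof (cases "p = \<infinity>")
      case True
      with b show ?thesis
        by (simp add: M_seminorm_integral_def gagliardo_seminorm_def C_def)
    next
      case False
      with p enn2real_ge_1[of p] have "1 \<le> P"
        by (auto simp: P_def)
      then have "ennpowr (gagliardo_integral s P u) (1 / P) \<le> ennreal ((B powr P) powr (1 / P))"
        using b False Bq[of P] by (simp add: gagliardo_seminorm_def P_def)
      then have "gagliardo_integral s P u \<le> ennreal (B powr P)"
        using B \<open>1 \<le> P\<close> by (intro le_ennpowr[of "1 / P" "B powr P"]) simp_all
      with False show ?thesis
        by (simp add: M_seminorm_integral_def P_def C_def)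
    qed
    then show "M_seminorm_integral s p u \<le> ennreal (max (B powr q) C)"
      by (rule order_trans) (intro ennreal_leI, simp)
  qed
qed

lemma M_seminorm_integral_uminus: "M_seminorm_integral s p (\<lambda>x. - u x) = M_seminorm_integral s p u"
proof -
  have "\<bar>- u x - - u y\<bar> = \<bar>u x - u y\<bar>" for x y
    by simp
  then show ?thesis
    by (simp only: M_seminorm_integral_def gagliardo_integral_def holder_seminorm_def)
qed

lemma holder_AE_zero:
  fixes u :: "real ^ 'n \<Rightarrow> real"
  assumes H: "holder_seminorm s u \<le> ennreal A" and A: "0 < A" and s: "0 < s"
    and ae: "AE x in lebesgue. u x = 0"
  shows "u x = 0"
proof -
  have "isCont u y" for y
    unfolding isCont_def
  proof (rule LIM_zero_cancel, rule tendsto_rabs_zero_cancel, rule tendsto_sandwich[where f = "\<lambda>_. 0"])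
    show "((\<lambda>x. A * norm (x - y) powr s) \<longlongrightarrow> 0) (at y)"
    proof -
      have "((\<lambda>x. A * norm (x - y) powr s) \<longlongrightarrow> A * norm (y - y) powr s) (at y)"
        using s by (intro tendsto_mult tendsto_const tendsto_powr' tendsto_norm tendsto_diff tendsto_ident_at) auto
      then show ?thesis by simp
    qed
    show "eventually (\<lambda>x. \<bar>u x - u y\<bar> \<le> A * norm (x - y) powr s) (at y)"
      using H A by (simp add: holder_seminorm_le_iff)
  qed auto
  then have "continuous_on UNIV u"
    by (simp add: continuous_at_imp_continuous_on)
  then have op: "open {x. u x \<noteq> 0}"
    by (intro open_Collect_neq) auto
  have "negligible {x. u x \<noteq> 0}"
    using ae op unfolding negligible_iff_null_sets by (subst (asm) AE_iff_null) auto
  then show ?thesis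
    using op open_not_negligible by blast
qed

section \<open>Dense sequences and completeness of the weighted Lebesgue space\<close>

lemma ex_dense_sequence:
  obtains d :: "nat \<Rightarrow> 'a :: {second_countable_topology, metric_space}"
  where "\<And>x r. 0 < r \<Longrightarrow> \<exists>i. x \<in> ball (d i) r"
proof -
  obtain D :: "'a set" where D: "countable D" "\<And>X. open X \<Longrightarrow> X \<noteq> {} \<Longrightarrow> \<exists>d\<in>D. d \<in> X"
    by (rule countable_dense_setE) blast
  have "D \<noteq> {}"
    using D(2)[of UNIV] by auto
  show thesis
  proof (rule that[of "from_nat_into D"])
    fix x :: 'a and r :: real assume "0 < r"
    then obtain y where "y \<in> D" "y \<in> ball x r"
      using D(2)[of "ball x r"] by auto
    moreover then obtain i where "from_nat_into D i = y"
      using from_nat_into_surj[OF D(1)] by blast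
    ultimately show "\<exists>i. x \<in> ball (from_nat_into D i) r"
      by (intro exI[of _ i]) (simp add: dist_commute)
  qed
qed

text \<open>The Riesz-Fischer argument: a subsequence with fast decreasing increments converges
  almost everywhere. Fatou's lemma then puts the limit into the space and bounds its distance from
  every late member of the full sequence.\<close>

lemma weighted_Cauchy_limit:
  fixes K :: "real ^ 'n \<Rightarrow> real" and w :: "nat \<Rightarrow> real ^ 'n \<Rightarrow> real"
  assumes r: "1 \<le> r" and K[measurable]: "K \<in> borel_measurable lebesgue" and Kpos: "\<And>x. 0 < K x"
    and w[measurable]: "\<And>k. w k \<in> borel_measurable lebesgue"
    and bound: "\<And>k. weighted_integral r K (w k) \<le> ennreal B"
    and Cauchy: "\<And>e. 0 < e \<Longrightarrow> \<exists>N. \<forall>i\<ge>N. \<forall>j\<ge>N. weighted_integral r K (\<lambda>x. w i x - w j x) \<le> ennreal e"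
  shows "\<exists>f\<in>weighted_Lebesgue r K. (\<lambda>k. weighted_norm r K (\<lambda>x. w k x - f x)) \<longlonglongrightarrow> 0"
proof -
  define c where "c k = inverse (2 * 2 powr r) ^ k" for k :: nat
  have "\<exists>N. \<forall>i\<ge>N. \<forall>j\<ge>N. weighted_integral r K (\<lambda>x. w i x - w j x) \<le> ennreal (c k)" for k
    by (rule Cauchy) (simp add: c_def)
  then obtain N where N: "\<And>k i j. i \<ge> N k \<Longrightarrow> j \<ge> N k \<Longrightarrow> weighted_integral r K (\<lambda>x. w i x - w j x) \<le> ennreal (c k)"
    by metis
  \<comment> \<open>Adding \<open>k\<close> and all earlier thresholds makes the indices increase
    while dominating both \<open>N k\<close> and \<open>k\<close>.\<close>
  define \<sigma> where "\<sigma> k = k + (\<Sum>i\<le>k. N i)" for k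
  have \<sigma>: "N k \<le> \<sigma> k" "k \<le> \<sigma> k" "\<sigma> k \<le> \<sigma> (Suc k)" for k
    by (auto simp: \<sigma>_def intro!: trans_le_add2 member_le_sum)
  have ae: "AE x in lebesgue. convergent (\<lambda>k. w (\<sigma> k) x)"
  proof (rule weighted_Cauchy_AE_convergent[OF r K Kpos])
    show "weighted_integral r K (\<lambda>x. w (\<sigma> (Suc k)) x - w (\<sigma> k) x) \<le> ennreal (inverse (2 * 2 powr r) ^ k)" for k
      using N[of k "\<sigma> (Suc k)" "\<sigma> k"] \<sigma>[of k] by (auto simp: c_def)
  qed measurable
  define f where "f x = lim (\<lambda>k. w (\<sigma> k) x)" for x
  have f[measurable]: "f \<in> borel_measurable lebesgue"
    unfolding f_def by measurable
  have lim: "AE x in lebesgue. (\<lambda>k. w (\<sigma> k) x) \<longlonglongrightarrow> f x"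
    using ae by eventually_elim (simp add: f_def convergent_LIMSEQ_iff)
  have "weighted_integral r K f \<le> liminf (\<lambda>k. weighted_integral r K (w (\<sigma> k)))"
    by (rule weighted_integral_Fatou) (use r lim in auto)
  also have "\<dots> \<le> ennreal B"
    by (rule Liminf_le) (use bound in auto)
  finally have "weighted_integral r K f < \<infinity>"
    by (rule le_less_trans) simp
  then have "f \<in> weighted_Lebesgue r K"
    by (auto simp: weighted_Lebesgue_def weighted_norm_def ennpowr_def)
  moreover have "(\<lambda>k. weighted_norm r K (\<lambda>x. w k x - f x)) \<longlonglongrightarrow> 0"
  proof (rule order_tendstoI)
    fix a :: ennreal assume "0 < a"
    then obtain b where b: "0 < b" "b < a"
      using dense by blast
    then obtain e where "b = ennreal e"
      by (cases b) auto
    then have e: "0 < e" "ennreal e < a"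
      using b by auto
    \<comment> \<open>\<open>e powr (1 / (1 / r))\<close> is e^r, written as
      \<open>ennpowr_le\<close> expects it for the exponent 1/r.\<close>
    obtain M where M: "\<And>i j. i \<ge> M \<Longrightarrow> j \<ge> M \<Longrightarrow>
        weighted_integral r K (\<lambda>x. w i x - w j x) \<le> ennreal (e powr (1 / (1 / r)))"
      using Cauchy[of "e powr (1 / (1 / r))"] e by auto
    have "weighted_norm r K (\<lambda>x. w m x - f x) < a" if m: "m \<ge> M" for m
    proof -
      have "weighted_integral r K (\<lambda>x. w m x - f x)
          \<le> liminf (\<lambda>k. weighted_integral r K (\<lambda>x. w m x - w (\<sigma> k) x))"
      proof (rule weighted_integral_Fatou)
        show "AE x in lebesgue. (\<lambda>k. w m x - w (\<sigma> k) x) \<longlonglongrightarrow> w m x - f x"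
          using lim by eventually_elim (intro tendsto_intros)
      qed (use r in auto)
      also have "\<dots> \<le> ennreal (e powr (1 / (1 / r)))"
      proof (rule Liminf_le)
        show "eventually (\<lambda>k. weighted_integral r K (\<lambda>x. w m x - w (\<sigma> k) x) \<le> ennreal (e powr (1 / (1 / r)))) sequentially"
          using eventually_ge_at_top[of M]
        proof eventually_elim
          case (elim k)
          then show ?case
            using M[OF m, of "\<sigma> k"] \<sigma>(2)[of k] by auto
        qed
      qed simp
      finally have "weighted_norm r K (\<lambda>x. w m x - f x) \<le> ennreal e"
        unfolding weighted_norm_def using r e by (intro ennpowr_le) auto
      with e show ?thesis
        by (meson le_less_trans)
    qed
    then show "eventually (\<lambda>k. weighted_norm r K (\<lambda>x. w k x - f x) < a) sequentially"
      unfolding eventually_sequentially by blast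
  qed auto
  ultimately show ?thesis
    by blast
qed

subsection \<open>The embedding\<close>

text \<open>The hypotheses on the weights in the form the estimates need: \<open>T\<close> is a
  finite integrability exponent of \<open>K\<close> on sets of finite measure, and
  \<open>tail\<close> expresses the decay of K V^(-\<tau>) with \<tau> already absorbed into
  \<open>m\<close>.\<close>

locale weight_pair =
  fixes K V :: "real ^ 'n \<Rightarrow> real" and p :: ennreal and s q r V\<^sub>0 T m :: real
  assumes p: "1 \<le> p" and s: "0 < s" and sp: "of_nat CARD('n) \<le> ennreal s * p"
    and q: "1 \<le> q" and qr: "q \<le> r"
    and K[measurable]: "K \<in> borel_measurable lebesgue" and Kpos: "\<And>x. 0 < K x"
    and V[measurable]: "V \<in> borel_measurable lebesgue" and Vpos: "\<And>x. 0 < V x"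
    and V\<^sub>0: "0 < V\<^sub>0" "\<And>x. V\<^sub>0 \<le> V x"
    and T: "1 < T" and K_T: "\<And>\<Omega>. \<Omega> \<in> sets lebesgue \<Longrightarrow> emeasure lebesgue \<Omega> < \<infinity> \<Longrightarrow>
      (\<integral>\<^sup>+x\<in>\<Omega>. ennreal (K x powr T) \<partial>lebesgue) < \<infinity>"
    and m: "q \<le> m" and tail: "\<And>e. 0 < e \<Longrightarrow> \<exists>\<Omega>\<in>sets lebesgue. emeasure lebesgue \<Omega> < \<infinity> \<and>
      (\<forall>x z. x \<notin> \<Omega> \<longrightarrow> 0 \<le> z \<longrightarrow> z powr r * K x \<le> e * (z powr q * V x + z powr m))"
begin

text \<open>Bounds are imposed on the integrals and not on their roots. This avoids
  \<open>ennpowr\<close> in the estimates; sums then lie in such a class again, with a larger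
  constant.\<close>

definition bounded_functions :: "real \<Rightarrow> (real ^ 'n \<Rightarrow> real) set" where
  "bounded_functions A = {u \<in> borel_measurable lebesgue.
     weighted_integral q V u \<le> ennreal A \<and> M_seminorm_integral s p u \<le> ennreal A}"

lemma bounded_functions_measurable: "u \<in> bounded_functions A \<Longrightarrow> u \<in> borel_measurable lebesgue"
  by (simp add: bounded_functions_def)

lemma bounded_functions_unweighted:
  assumes u: "u \<in> bounded_functions A" and A: "0 < A"
  shows "weighted_integral q (\<lambda>_. 1) u \<le> ennreal (max A (A / V\<^sub>0))"
    "M_seminorm_integral s p u \<le> ennreal (max A (A / V\<^sub>0))"
proof -
  have [measurable]: "u \<in> borel_measurable lebesgue"
    using u by (rule bounded_functions_measurable)
  have "ennreal V\<^sub>0 * weighted_integral q (\<lambda>_. 1) u = (\<integral>\<^sup>+x. ennreal V\<^sub>0 * ennreal (\<bar>u x\<bar> powr q * 1) \<partial>lebesgue)"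
    unfolding weighted_integral_def by (intro nn_integral_cmult[symmetric]) measurable
  also have "\<dots> \<le> weighted_integral q V u"
    unfolding weighted_integral_def
  proof (rule nn_integral_mono)
    fix x
    have "V\<^sub>0 * \<bar>u x\<bar> powr q \<le> V x * \<bar>u x\<bar> powr q"
      by (intro mult_right_mono V\<^sub>0) simp
    then show "ennreal V\<^sub>0 * ennreal (\<bar>u x\<bar> powr q * 1) \<le> ennreal (\<bar>u x\<bar> powr q * V x)"
      using V\<^sub>0(1) by (simp add: mult.commute ennreal_leI flip: ennreal_mult)
  qed
  also have "\<dots> \<le> ennreal A"
    using u by (simp add: bounded_functions_def)
  finally have "weighted_integral q (\<lambda>_. 1) u \<le> ennreal (A / V\<^sub>0)"
    using V\<^sub>0(1) A by (intro le_divide_ennrealI) auto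
  then show "weighted_integral q (\<lambda>_. 1) u \<le> ennreal (max A (A / V\<^sub>0))"
    by (rule order_trans) (intro ennreal_leI, simp)
  have "M_seminorm_integral s p u \<le> ennreal A"
    using u by (simp add: bounded_functions_def)
  then show "M_seminorm_integral s p u \<le> ennreal (max A (A / V\<^sub>0))"
    by (rule order_trans) (intro ennreal_leI, simp)
qed

lemma bounded_functions_Lebesgue:
  assumes A: "0 < A" and k: "q \<le> k"
  shows "\<exists>C>0. \<forall>u\<in>bounded_functions A. weighted_integral k (\<lambda>_. 1) u \<le> ennreal C"
proof -
  have "0 < max A (A / V\<^sub>0)"
    using A by simp
  from M_seminorm_Lebesgue_bound[OF p s sp q k this] show ?thesis
    using bounded_functions_unweighted[OF _ A] bounded_functions_measurable by meson
qed

lemma bounded_functions_add: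
  assumes A: "0 < A"
  shows "\<exists>B>0. \<forall>u\<in>bounded_functions A. \<forall>w\<in>bounded_functions A. (\<lambda>x. u x + w x) \<in> bounded_functions B"
proof -
  define B where "B = max (2 * 2 powr q * A) (2 * 2 powr (enn2real p) * A)"
  show ?thesis
  proof (intro exI[of _ B] conjI ballI)
    show "0 < B"
      using A by (simp add: B_def less_max_iff_disj)
    fix u w assume "u \<in> bounded_functions A" "w \<in> bounded_functions A"
    then have [measurable]: "u \<in> borel_measurable lebesgue" "w \<in> borel_measurable lebesgue"
      and u: "weighted_integral q V u \<le> ennreal A" "M_seminorm_integral s p u \<le> ennreal A"
      and w: "weighted_integral q V w \<le> ennreal A" "M_seminorm_integral s p w \<le> ennreal A"
      by (auto simp: bounded_functions_def)
    have "weighted_integral q V (\<lambda>x. u x + w x)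
        \<le> ennreal (2 powr q) * (weighted_integral q V u + weighted_integral q V w)"
      using q Vpos by (intro weighted_integral_add) auto
    also have "\<dots> \<le> ennreal (2 powr q) * (ennreal A + ennreal A)"
      using u w by (intro mult_left_mono add_mono) auto
    also have "\<dots> = ennreal (2 * 2 powr q * A)"
      using A by (intro ennreal_mult_double) auto
    also have "\<dots> \<le> ennreal B"
      by (intro ennreal_leI) (simp add: B_def)
    finally have 1: "weighted_integral q V (\<lambda>x. u x + w x) \<le> ennreal B" .
    have "M_seminorm_integral s p (\<lambda>x. u x + w x) \<le> ennreal (2 * 2 powr (enn2real p) * A)"
      using p u w A by (intro M_seminorm_integral_add) auto
    also have "\<dots> \<le> ennreal B"
      by (intro ennreal_leI) (simp add: B_def)
    finally show "(\<lambda>x. u x + w x) \<in> bounded_functions B"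
      using 1 by (simp add: bounded_functions_def)
  qed
qed

lemma bounded_functions_uminus:
  "u \<in> bounded_functions A \<Longrightarrow> (\<lambda>x. - u x) \<in> bounded_functions A"
  by (auto simp: bounded_functions_def weighted_integral_def M_seminorm_integral_uminus)

text \<open>Write \<open>u\<close> as the sum of an approximant of finite norm and an error of norm
  below 1; both lie in one class, and classes are stable under addition.\<close>

lemma M_space_bounded_functions:
  assumes "u \<in> M_space s q p V"
  shows "\<exists>A>0. u \<in> bounded_functions A"
proof -
  obtain \<phi> where u: "u \<in> borel_measurable lebesgue"
    and \<phi>: "\<And>k. \<phi> k \<in> C1c" "\<And>k. M_norm s q p V (\<phi> k) < \<infinity>"
    and lim: "(\<lambda>k. M_norm s q p V (\<lambda>x. u x - \<phi> k x)) \<longlonglongrightarrow> 0"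
    using assms unfolding M_space_def by blast
  have "eventually (\<lambda>k. M_norm s q p V (\<lambda>x. u x - \<phi> k x) < 1) sequentially"
    using lim by (rule order_tendstoD) simp
  then obtain k where k: "M_norm s q p V (\<lambda>x. u x - \<phi> k x) < 1"
    by (auto simp: eventually_sequentially)
  have \<phi>m: "\<phi> k \<in> borel_measurable lebesgue"
    using C1c_subset_M_space[OF \<phi> q p, of k] by (simp add: M_space_def)
  obtain b where b: "M_norm s q p V (\<phi> k) = ennreal b" "0 \<le> b"
    using \<phi>(2)[of k] by (cases "M_norm s q p V (\<phi> k)") auto
  define B where "B = b + 1"
  have B: "0 < B"
    using b by (simp add: B_def)
  have B1: "M_norm s q p V (\<phi> k) \<le> ennreal B"
    unfolding b(1) B_def by (rule ennreal_leI) simp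
  have "ennreal 1 \<le> ennreal B"
    unfolding B_def using b(2) by (intro ennreal_leI) simp
  with k have B2: "M_norm s q p V (\<lambda>x. u x - \<phi> k x) \<le> ennreal B"
    by (simp add: order_trans[OF less_imp_le])
  obtain A where A: "0 < A" and bd: "\<And>w :: real ^ 'n \<Rightarrow> real. M_norm s q p V w \<le> ennreal B \<Longrightarrow>
      weighted_integral q V w \<le> ennreal A \<and> M_seminorm_integral s p w \<le> ennreal A"
    using M_norm_boundD[OF q p B] by blast
  have "\<phi> k \<in> bounded_functions A" "(\<lambda>x. u x - \<phi> k x) \<in> bounded_functions A"
    unfolding bounded_functions_def using bd[OF B1] bd[OF B2] \<phi>m u by auto
  moreover obtain D where D: "0 < D" "\<And>u w. u \<in> bounded_functions A \<Longrightarrow> w \<in> bounded_functions A \<Longrightarrow>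
      (\<lambda>x. u x + w x) \<in> bounded_functions D"
    using bounded_functions_add[OF A] by blast
  ultimately have "(\<lambda>x. (u x - \<phi> k x) + \<phi> k x) \<in> bounded_functions D"
    by (intro D(2))
  with D(1) show ?thesis by auto
qed

text \<open>On \<Omega> Young's inequality separates \<open>K\<close> from |u|^r; off \<Omega> the
  pointwise tail estimate applies. Both parameters are free: \<open>e\<close> is fixed together with
  \<Omega>, and \<nu> can be chosen afterwards.\<close>

lemma weighted_integral_split:
  assumes u[measurable]: "u \<in> borel_measurable lebesgue" and \<Omega>[measurable]: "\<Omega> \<in> sets lebesgue"
    and le: "\<And>x z. x \<notin> \<Omega> \<Longrightarrow> 0 \<le> z \<Longrightarrow> z powr r * K x \<le> e * (z powr q * V x + z powr m)"
    and e: "0 < e" and \<nu>: "0 < \<nu>"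
  shows "weighted_integral r K u
    \<le> ennreal e * (weighted_integral q V u + weighted_integral m (\<lambda>_. 1) u)
      + (ennreal \<nu> * (\<integral>\<^sup>+x\<in>\<Omega>. ennreal (K x powr T) \<partial>lebesgue)
      + ennreal (\<nu> powr (- 1 / (T - 1))) * (\<integral>\<^sup>+x\<in>\<Omega>. ennreal (\<bar>u x\<bar> powr (r * T / (T - 1))) \<partial>lebesgue))"
proof -
  define N where "N = \<nu> powr (- 1 / (T - 1))"
  have N: "0 < N" using \<nu> by (simp add: N_def)
  define F where "F x = ennreal (\<bar>u x\<bar> powr q * V x) + ennreal (\<bar>u x\<bar> powr m * 1)" for x
  define G where "G x = ennreal (K x powr T) * indicator \<Omega> x" for x
  define H where "H x = ennreal (\<bar>u x\<bar> powr (r * T / (T - 1))) * indicator \<Omega> x" for x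
  have [measurable]: "F \<in> borel_measurable lebesgue" "G \<in> borel_measurable lebesgue" "H \<in> borel_measurable lebesgue"
    unfolding F_def G_def H_def by measurable
  have "weighted_integral r K u \<le> (\<integral>\<^sup>+x. ennreal e * F x + (ennreal \<nu> * G x + ennreal N * H x) \<partial>lebesgue)"
    unfolding weighted_integral_def
  proof (rule nn_integral_mono)
    fix x
    show "ennreal (\<bar>u x\<bar> powr r * K x) \<le> ennreal e * F x + (ennreal \<nu> * G x + ennreal N * H x)"
    proof (cases "x \<in> \<Omega>")
      case True
      have "K x * \<bar>u x\<bar> powr r \<le> \<nu> * K x powr T + N * (\<bar>u x\<bar> powr r) powr (T / (T - 1))"
        unfolding N_def using T \<nu> Kpos[of x] by (intro Youngs_inequality_scaled) auto
      then have "ennreal (\<bar>u x\<bar> powr r * K x) \<le> ennreal (\<nu> * K x powr T + N * \<bar>u x\<bar> powr (r * T / (T - 1)))"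
        by (intro ennreal_leI) (simp add: powr_powr mult.commute)
      also have "\<dots> = ennreal \<nu> * G x + ennreal N * H x"
        using True \<nu> N by (simp add: G_def H_def ennreal_mult)
      finally show ?thesis
        by (rule add_increasing[OF zero_le])
    next
      case False
      have "ennreal (\<bar>u x\<bar> powr r * K x) \<le> ennreal (e * (\<bar>u x\<bar> powr q * V x + \<bar>u x\<bar> powr m))"
        using le[OF False] by (intro ennreal_leI) auto
      also have "\<dots> = ennreal e * F x"
        using e Vpos[of x] by (simp add: F_def ennreal_mult less_imp_le)
      finally show ?thesis
        by (rule add_increasing2[OF zero_le])
    qed
  qed
  also have "\<dots> = ennreal e * (\<integral>\<^sup>+x. F x \<partial>lebesgue)
      + (ennreal \<nu> * (\<integral>\<^sup>+x. G x \<partial>lebesgue) + ennreal N * (\<integral>\<^sup>+x. H x \<partial>lebesgue))"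
    by (simp add: nn_integral_add nn_integral_cmult)
  also have "(\<integral>\<^sup>+x. F x \<partial>lebesgue) = weighted_integral q V u + weighted_integral m (\<lambda>_. 1) u"
    unfolding F_def weighted_integral_def by (intro nn_integral_add) measurable
  finally show ?thesis
    by (simp add: G_def H_def N_def)
qed

lemma conjugate_exponent_ge: "q \<le> r * T / (T - 1)"
proof -
  have "r * (T - 1) \<le> r * T"
    using q qr by (intro mult_left_mono) auto
  then have "r \<le> r * T / (T - 1)"
    using T by (simp add: le_divide_eq)
  with qr show ?thesis
    by simp
qed

lemma set_nn_integral_le_weighted:
  "(\<integral>\<^sup>+x\<in>\<Omega>. ennreal (\<bar>u x\<bar> powr k) \<partial>lebesgue) \<le> weighted_integral k (\<lambda>_. 1) u"
  unfolding weighted_integral_def by (intro nn_integral_mono) (simp split: split_indicator)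

text \<open>\<open>weighted_integral_split\<close> with both parameters equal to 1; the integrals of
  |u|^m and of |u|^(rT/(T-1)) are bounded because both exponents are at least
  \<open>q\<close>.\<close>

lemma weighted_integral_bounded:
  assumes A: "0 < A"
  shows "\<exists>B>0. \<forall>u\<in>bounded_functions A. weighted_integral r K u \<le> ennreal B"
proof -
  obtain \<Omega> where \<Omega>: "\<Omega> \<in> sets lebesgue" "emeasure lebesgue \<Omega> < \<infinity>"
    and le: "\<And>x z. x \<notin> \<Omega> \<Longrightarrow> 0 \<le> z \<Longrightarrow> z powr r * K x \<le> 1 * (z powr q * V x + z powr m)"
    using tail[of 1] by auto
  obtain \<kappa> where \<kappa>: "(\<integral>\<^sup>+x\<in>\<Omega>. ennreal (K x powr T) \<partial>lebesgue) = ennreal \<kappa>" "0 \<le> \<kappa>"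
    using K_T[OF \<Omega>] by (cases "\<integral>\<^sup>+x\<in>\<Omega>. ennreal (K x powr T) \<partial>lebesgue") auto
  obtain C where C: "0 < C" "\<And>u. u \<in> bounded_functions A \<Longrightarrow> weighted_integral m (\<lambda>_. 1) u \<le> ennreal C"
    using bounded_functions_Lebesgue[OF A m] by blast
  obtain D where D: "0 < D" "\<And>u. u \<in> bounded_functions A \<Longrightarrow> weighted_integral (r * T / (T - 1)) (\<lambda>_. 1) u \<le> ennreal D"
    using bounded_functions_Lebesgue[OF A conjugate_exponent_ge] by blast
  show ?thesis
  proof (intro exI[of _ "(A + C) + (\<kappa> + D)"] conjI ballI)
    fix u assume u: "u \<in> bounded_functions A"
    have "weighted_integral r K u
      \<le> ennreal 1 * (weighted_integral q V u + weighted_integral m (\<lambda>_. 1) u)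
      + (ennreal 1 * (\<integral>\<^sup>+x\<in>\<Omega>. ennreal (K x powr T) \<partial>lebesgue)
      + ennreal (1 powr (- 1 / (T - 1))) * (\<integral>\<^sup>+x\<in>\<Omega>. ennreal (\<bar>u x\<bar> powr (r * T / (T - 1))) \<partial>lebesgue))"
      by (rule weighted_integral_split[OF bounded_functions_measurable[OF u] \<Omega>(1) le]) auto
    also have "\<dots> = (weighted_integral q V u + weighted_integral m (\<lambda>_. 1) u)
      + (ennreal \<kappa> + (\<integral>\<^sup>+x\<in>\<Omega>. ennreal (\<bar>u x\<bar> powr (r * T / (T - 1))) \<partial>lebesgue))"
      by (simp add: \<kappa>)
    also have "\<dots> \<le> (ennreal A + ennreal C) + (ennreal \<kappa> + ennreal D)"
      using u C(2)[OF u] D(2)[OF u] set_nn_integral_le_weighted[of u "r * T / (T - 1)" \<Omega>]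
      by (intro add_mono order_refl) (auto simp: bounded_functions_def intro: order_trans)
    also have "\<dots> = ennreal ((A + C) + (\<kappa> + D))"
      using A C D \<kappa> by simp
    finally show "weighted_integral r K u \<le> ennreal ((A + C) + (\<kappa> + D))" .
  qed (use A C D \<kappa> in auto)
qed

text \<open>Smallness in measure improves to smallness of the integral through a bound for the
  doubled exponent 2k. Outside the exceptional set \<open>E\<close> the integrand is at most (3c)^k.
  On \<open>E\<close>, z = |u|^k satisfies z \<le> \<nu> z^2 + 1/\<nu>, whose first term is small by
  the choice of \<nu> and whose second is small because \<open>E\<close> is.\<close>

lemma set_nn_integral_small:
  fixes d :: "nat \<Rightarrow> real ^ 'n"
  assumes dense: "\<And>x r. 0 < r \<Longrightarrow> \<exists>i. x \<in> ball (d i) r"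
    and A: "0 < A" and e: "0 < e" and k: "q \<le> k"
    and \<Omega>[measurable]: "\<Omega> \<in> sets lebesgue" and fin: "emeasure lebesgue \<Omega> < \<infinity>"
  shows "\<exists>j I. \<exists>\<delta>>0. \<forall>u\<in>bounded_functions A.
    (\<forall>i<I. \<bar>set_lebesgue_integral lebesgue (ball (d i) (1 / real (Suc j))) u\<bar> \<le> \<delta>) \<longrightarrow>
    (\<integral>\<^sup>+x\<in>\<Omega>. ennreal (\<bar>u x\<bar> powr k) \<partial>lebesgue) \<le> ennreal e"
proof -
  have k0: "0 < k" using k q by simp
  have "q \<le> 2 * k" using k q by simp
  then obtain C where C: "0 < C" "\<And>u. u \<in> bounded_functions A \<Longrightarrow> weighted_integral (2 * k) (\<lambda>_. 1) u \<le> ennreal C"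
    using bounded_functions_Lebesgue[OF A] by blast
  define \<omega> where "\<omega> = measure lebesgue \<Omega>"
  have \<omega>: "emeasure lebesgue \<Omega> = ennreal \<omega>" "0 \<le> \<omega>"
    using fin by (auto simp: \<omega>_def emeasure_eq_ennreal_measure)
  define \<nu> where "\<nu> = e / (3 * C)"
  have \<nu>: "0 < \<nu>" using e C by (simp add: \<nu>_def)
  \<comment> \<open>Chosen so that (3c)^k times \<omega> is at most e/3; the summand 1 avoids a
    division by 0 when \<Omega> is a null set.\<close>
  define c where "c = (e / (3 * (\<omega> + 1))) powr (1 / k) / 3"
  have c: "0 < c" using e \<omega> by (simp add: c_def)
  have ck: "(3 * c) powr k = e / (3 * (\<omega> + 1))"
    using k0 e \<omega> by (simp add: c_def powr_powr)
  \<comment> \<open>The measure allowed for \<open>E\<close>: multiplied by 1/\<nu> it leaves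
    e/3.\<close>
  have \<eta>: "0 < \<nu> * (e / 3)" using \<nu> e by simp
  have A': "0 < max A (A / V\<^sub>0)" using A by simp
  obtain j I \<delta> where \<delta>: "0 < \<delta>" and small: "\<forall>u \<in> borel_measurable lebesgue. weighted_integral q (\<lambda>_. 1) u \<le> ennreal (max A (A / V\<^sub>0)) \<longrightarrow>
    M_seminorm_integral s p u \<le> ennreal (max A (A / V\<^sub>0)) \<longrightarrow>
    (\<forall>i<I. \<bar>set_lebesgue_integral lebesgue (ball (d i) (1 / real (Suc j))) u\<bar> \<le> \<delta>) \<longrightarrow>
    emeasure lebesgue (\<Omega> \<inter> {x. 3 * c < \<bar>u x\<bar>}) \<le> ennreal (\<nu> * (e / 3))"
    using small_means_imp_small_measure[OF dense p s q A' c \<eta> \<Omega> fin] by blast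
  show ?thesis
  proof (rule exI[of _ j], rule exI[of _ I], rule exI[of _ \<delta>], intro conjI ballI impI \<delta>)
    fix u assume u: "u \<in> bounded_functions A"
      and means: "\<forall>i<I. \<bar>set_lebesgue_integral lebesgue (ball (d i) (1 / real (Suc j))) u\<bar> \<le> \<delta>"
    have um[measurable]: "u \<in> borel_measurable lebesgue"
      using u by (rule bounded_functions_measurable)
    define E where "E = \<Omega> \<inter> {x. 3 * c < \<bar>u x\<bar>}"
    have Em[measurable]: "E \<in> sets lebesgue"
      unfolding E_def by (intro sets.Int) auto
    have E: "emeasure lebesgue E \<le> ennreal (\<nu> * (e / 3))"
      using small um bounded_functions_unweighted[OF u A] means unfolding E_def by blast
    have "(\<integral>\<^sup>+x\<in>\<Omega>. ennreal (\<bar>u x\<bar> powr k) \<partial>lebesgue)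
      \<le> (\<integral>\<^sup>+x. ennreal ((3 * c) powr k) * indicator \<Omega> x
          + (ennreal \<nu> * ennreal (\<bar>u x\<bar> powr (2 * k) * 1) + ennreal (1 / \<nu>) * indicator E x) \<partial>lebesgue)"
    proof (rule nn_integral_mono)
      fix x
      show "ennreal (\<bar>u x\<bar> powr k) * indicator \<Omega> x \<le> ennreal ((3 * c) powr k) * indicator \<Omega> x
          + (ennreal \<nu> * ennreal (\<bar>u x\<bar> powr (2 * k) * 1) + ennreal (1 / \<nu>) * indicator E x)"
      proof (cases "x \<in> E")
        case False
        then have "ennreal (\<bar>u x\<bar> powr k) * indicator \<Omega> x \<le> ennreal ((3 * c) powr k) * indicator \<Omega> x"
          using k0 c by (auto simp: E_def split: split_indicator intro!: ennreal_leI powr_mono2)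
        then show ?thesis
          by (rule add_increasing2[OF zero_le])
      next
        case True
        define z where "z = \<bar>u x\<bar> powr k"
        have z: "0 \<le> z" "\<bar>u x\<bar> powr (2 * k) = z * z"
          by (auto simp: z_def simp flip: powr_add)
        have "z \<le> \<nu> * (z * z) + 1 / \<nu>"
        proof (cases "\<nu> * z \<le> 1")
          case True
          then have "z \<le> 1 / \<nu>" using \<nu> by (simp add: field_simps)
          then show ?thesis using \<nu> z by (simp add: add_increasing)
        next
          case False
          then have "1 * z \<le> (\<nu> * z) * z"
            using z by (intro mult_right_mono) auto
          then show ?thesis using \<nu> by (simp add: add_increasing2 mult.assoc)
        qed
        then have "ennreal z \<le> ennreal \<nu> * ennreal (\<bar>u x\<bar> powr (2 * k) * 1) + ennreal (1 / \<nu>)"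
          using \<nu> z by (simp add: ennreal_leI flip: ennreal_mult ennreal_plus)
        then have "ennreal z * indicator \<Omega> x
            \<le> ennreal \<nu> * ennreal (\<bar>u x\<bar> powr (2 * k) * 1) + ennreal (1 / \<nu>) * indicator E x"
          using True by (simp add: E_def)
        then show ?thesis
          unfolding z_def by (rule add_increasing[OF zero_le])
      qed
    qed
    also have "\<dots> = ennreal ((3 * c) powr k) * emeasure lebesgue \<Omega>
        + (ennreal \<nu> * weighted_integral (2 * k) (\<lambda>_. 1) u + ennreal (1 / \<nu>) * emeasure lebesgue E)"
      unfolding weighted_integral_def
      by (simp add: nn_integral_add nn_integral_cmult nn_integral_cmult_indicator)
    also have "\<dots> \<le> ennreal ((3 * c) powr k) * ennreal \<omega>
        + (ennreal \<nu> * ennreal C + ennreal (1 / \<nu>) * ennreal (\<nu> * (e / 3)))"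
      unfolding \<omega>(1) using C(2)[OF u] E by (intro add_mono mult_left_mono) auto
    also have "\<dots> = ennreal ((3 * c) powr k * \<omega> + (\<nu> * C + 1 / \<nu> * (\<nu> * (e / 3))))"
      using \<omega> \<nu> C e by (simp add: less_imp_le flip: ennreal_mult ennreal_plus)
    also have "\<dots> \<le> ennreal e"
    proof (rule ennreal_leI)
      have "(3 * c) powr k * \<omega> \<le> e / 3"
        unfolding ck using e \<omega> by (simp add: field_simps)
      moreover have "\<nu> * C = e / 3" "1 / \<nu> * (\<nu> * (e / 3)) = e / 3"
        using C \<nu> by (simp_all add: \<nu>_def)
      ultimately show "(3 * c) powr k * \<omega> + (\<nu> * C + 1 / \<nu> * (\<nu> * (e / 3))) \<le> e"
        by simp
    qed
    finally show "(\<integral>\<^sup>+x\<in>\<Omega>. ennreal (\<bar>u x\<bar> powr k) \<partial>lebesgue) \<le> ennreal e" .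
  qed
qed

text \<open>Each of the three terms of \<open>weighted_integral_split\<close> receives e/3. The
  parameters are chosen in turn: \<open>e1\<close> against the bounds \<open>A\<close> and
  \<open>C\<close>, which fixes \<Omega>; \<nu> against the integral \<kappa> of K^T over \<Omega>;
  finally the ball integrals against the resulting constant \<open>N\<close>.\<close>

lemma weighted_integral_small:
  fixes d :: "nat \<Rightarrow> real ^ 'n"
  assumes dense: "\<And>x r. 0 < r \<Longrightarrow> \<exists>i. x \<in> ball (d i) r" and A: "0 < A" and e: "0 < e"
  shows "\<exists>j I. \<exists>\<delta>>0. \<forall>u\<in>bounded_functions A.
    (\<forall>i<I. \<bar>set_lebesgue_integral lebesgue (ball (d i) (1 / real (Suc j))) u\<bar> \<le> \<delta>) \<longrightarrow>
    weighted_integral r K u \<le> ennreal e"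
proof -
  obtain C where C: "0 < C" "\<And>u. u \<in> bounded_functions A \<Longrightarrow> weighted_integral m (\<lambda>_. 1) u \<le> ennreal C"
    using bounded_functions_Lebesgue[OF A m] by blast
  define e1 where "e1 = e / (3 * (A + C))"
  have e1: "0 < e1" "e1 * (A + C) = e / 3"
    using e A C by (auto simp: e1_def field_simps add_pos_pos)
  obtain \<Omega> where \<Omega>: "\<Omega> \<in> sets lebesgue" "emeasure lebesgue \<Omega> < \<infinity>"
    and le: "\<And>x z. x \<notin> \<Omega> \<Longrightarrow> 0 \<le> z \<Longrightarrow> z powr r * K x \<le> e1 * (z powr q * V x + z powr m)"
    using tail[OF e1(1)] by auto
  obtain \<kappa> where \<kappa>: "(\<integral>\<^sup>+x\<in>\<Omega>. ennreal (K x powr T) \<partial>lebesgue) = ennreal \<kappa>" "0 \<le> \<kappa>"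
    using K_T[OF \<Omega>] by (cases "\<integral>\<^sup>+x\<in>\<Omega>. ennreal (K x powr T) \<partial>lebesgue") auto
  define \<nu> where "\<nu> = e / (3 * (\<kappa> + 1))"
  have \<nu>: "0 < \<nu>" "\<nu> * \<kappa> \<le> e / 3"
    using e \<kappa> by (auto simp: \<nu>_def field_simps)
  define N where "N = \<nu> powr (- 1 / (T - 1))"
  have N: "0 < N" using \<nu> by (simp add: N_def)
  have e2: "0 < e / (3 * N)" using e N by simp
  obtain j I \<delta> where \<delta>: "0 < \<delta>" and small: "\<forall>u\<in>bounded_functions A.
    (\<forall>i<I. \<bar>set_lebesgue_integral lebesgue (ball (d i) (1 / real (Suc j))) u\<bar> \<le> \<delta>) \<longrightarrow>
    (\<integral>\<^sup>+x\<in>\<Omega>. ennreal (\<bar>u x\<bar> powr (r * T / (T - 1))) \<partial>lebesgue) \<le> ennreal (e / (3 * N))"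
    using set_nn_integral_small[OF dense A e2 conjugate_exponent_ge \<Omega>] by blast
  show ?thesis
  proof (rule exI[of _ j], rule exI[of _ I], rule exI[of _ \<delta>], intro conjI ballI impI \<delta>)
    fix u assume u: "u \<in> bounded_functions A"
      and means: "\<forall>i<I. \<bar>set_lebesgue_integral lebesgue (ball (d i) (1 / real (Suc j))) u\<bar> \<le> \<delta>"
    have "weighted_integral r K u
      \<le> ennreal e1 * (weighted_integral q V u + weighted_integral m (\<lambda>_. 1) u)
      + (ennreal \<nu> * (\<integral>\<^sup>+x\<in>\<Omega>. ennreal (K x powr T) \<partial>lebesgue)
      + ennreal N * (\<integral>\<^sup>+x\<in>\<Omega>. ennreal (\<bar>u x\<bar> powr (r * T / (T - 1))) \<partial>lebesgue))"
      unfolding N_def by (rule weighted_integral_split[OF bounded_functions_measurable[OF u] \<Omega>(1) le e1(1) \<nu>(1)])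
    also have "\<dots> \<le> ennreal e1 * (ennreal A + ennreal C) + (ennreal \<nu> * ennreal \<kappa> + ennreal N * ennreal (e / (3 * N)))"
      using u C(2)[OF u] small means unfolding \<kappa>(1)
      by (intro add_mono mult_left_mono order_refl) (auto simp: bounded_functions_def)
    also have "\<dots> = ennreal (e1 * (A + C) + (\<nu> * \<kappa> + N * (e / (3 * N))))"
      using A C e1(1) \<nu>(1) \<kappa> N e by (simp add: less_imp_le flip: ennreal_mult ennreal_plus)
    also have "\<dots> \<le> ennreal e"
      using e1(2) \<nu>(2) N by (intro ennreal_leI) simp
    finally show "weighted_integral r K u \<le> ennreal e" .
  qed
qed

text \<open>Along a diagonal subsequence the integrals over all countably many balls converge. For a
  given \<open>e\<close> only finitely many balls of one radius matter, so the differences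
  eventually satisfy the criterion of \<open>weighted_integral_small\<close> and the subsequence is
  Cauchy for \<open>K\<close>.\<close>

lemma bounded_functions_convergent_subsequence:
  fixes u :: "nat \<Rightarrow> real ^ 'n \<Rightarrow> real"
  assumes A: "0 < A" and u: "\<And>k. u k \<in> bounded_functions A"
  shows "\<exists>\<sigma>. strict_mono \<sigma> \<and> (\<exists>f\<in>weighted_Lebesgue r K.
    (\<lambda>k. weighted_norm r K (\<lambda>x. u (\<sigma> k) x - f x)) \<longlonglongrightarrow> 0)"
proof -
  obtain d :: "nat \<Rightarrow> real ^ 'n" where dense: "\<And>x r. 0 < r \<Longrightarrow> \<exists>i. x \<in> ball (d i) r"
    using ex_dense_sequence by blast
  \<comment> \<open>Integrals instead of means: they are bounded uniformly over all balls of radius at most \<open>1\<close>,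
    as the extraction of a subsequence requires.\<close>
  define F where "F k = (\<lambda>(j, i). set_lebesgue_integral lebesgue (ball (d i) (1 / real (Suc j))) (u k))"
    for k :: nat
  define A' where "A' = max A (A / V\<^sub>0)"
  have A': "0 < A'" using A by (simp add: A'_def)
  have int: "set_integrable lebesgue (ball c h) (u k)"
    and le: "\<bar>set_lebesgue_integral lebesgue (ball c h) (u k)\<bar> \<le> measure lebesgue (ball c h) + A'" for k c h
    using ball_integral_bound[OF bounded_functions_measurable[OF u] q _ bounded_functions_unweighted(1)[OF u A]] A'
    by (auto simp: A'_def)
  have Fb: "norm (F k x) \<le> unit_ball_vol (real CARD('n)) + A'" for k x
  proof -
    obtain j i where x: "x = (j, i)" by (cases x)
    have "measure lebesgue (ball (d i) (1 / real (Suc j))) \<le> unit_ball_vol (real CARD('n))"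
      by (simp add: content_ball mult_left_le power_le_one)
    with le[of "d i" "1 / real (Suc j)" k] show ?thesis
      by (simp add: F_def x)
  qed
  \<comment> \<open>Cantor's diagonal argument over the countable set of pairs of a radius index and
    a centre index.\<close>
  obtain \<sigma> :: "nat \<Rightarrow> nat" where \<sigma>: "strict_mono \<sigma>" "\<And>x. \<exists>l. (\<lambda>n. F (\<sigma> n) x) \<longlonglongrightarrow> l"
  proof (rule function_convergent_subsequence[of "UNIV :: (nat \<times> nat) set" F])
    show "norm (F k x) \<le> unit_ball_vol (real CARD('n)) + A'" for k x
      by (rule Fb)
  qed auto
  obtain B where B: "0 < B" "\<And>v w. v \<in> bounded_functions A \<Longrightarrow> w \<in> bounded_functions A \<Longrightarrow>
      (\<lambda>x. v x + w x) \<in> bounded_functions B"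
    using bounded_functions_add[OF A] by blast
  \<comment> \<open>Differences leave the class of \<open>A\<close>, so the smallness criterion is
    applied in the larger class of \<open>B\<close>.\<close>
  have diff: "(\<lambda>x. u i x - u j x) \<in> bounded_functions B" for i j
    using B(2)[OF u[of i] bounded_functions_uminus[OF u[of j]]] by simp
  obtain R where R: "\<And>w. w \<in> bounded_functions A \<Longrightarrow> weighted_integral r K w \<le> ennreal R"
    using weighted_integral_bounded[OF A] by blast
  have "\<exists>f\<in>weighted_Lebesgue r K. (\<lambda>k. weighted_norm r K (\<lambda>x. u (\<sigma> k) x - f x)) \<longlonglongrightarrow> 0"
  proof (rule weighted_Cauchy_limit[OF _ K Kpos])
    show "1 \<le> r" using q qr by simp
    show "u (\<sigma> k) \<in> borel_measurable lebesgue" "weighted_integral r K (u (\<sigma> k)) \<le> ennreal R" for k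
      using u R bounded_functions_measurable by auto
    fix e :: real assume e: "0 < e"
    obtain j I \<delta> where \<delta>: "0 < \<delta>" and small: "\<forall>w\<in>bounded_functions B.
      (\<forall>i<I. \<bar>set_lebesgue_integral lebesgue (ball (d i) (1 / real (Suc j))) w\<bar> \<le> \<delta>) \<longrightarrow>
      weighted_integral r K w \<le> ennreal e"
      using weighted_integral_small[OF dense B(1) e] by blast
    have "\<exists>N. \<forall>a\<ge>N. \<forall>b\<ge>N. \<bar>F (\<sigma> a) (j, i) - F (\<sigma> b) (j, i)\<bar> < \<delta>" for i
    proof -
      have "Cauchy (\<lambda>n. F (\<sigma> n) (j, i))"
        using \<sigma>(2) by (auto intro: LIMSEQ_imp_Cauchy)
      with \<delta> show ?thesis
        unfolding Cauchy_def dist_real_def by blast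
    qed
    then obtain N where N: "\<And>i a b. a \<ge> N i \<Longrightarrow> b \<ge> N i \<Longrightarrow> \<bar>F (\<sigma> a) (j, i) - F (\<sigma> b) (j, i)\<bar> < \<delta>"
      by metis
    show "\<exists>M. \<forall>a\<ge>M. \<forall>b\<ge>M. weighted_integral r K (\<lambda>x. u (\<sigma> a) x - u (\<sigma> b) x) \<le> ennreal e"
    \<comment> \<open>The witness is \<open>sum N {..<I}\<close>, which dominates each of the
      finitely many thresholds \<open>N i\<close>.\<close>
    proof (intro exI allI impI)
      fix a b assume ab: "sum N {..<I} \<le> a" "sum N {..<I} \<le> b"
      have "\<bar>set_lebesgue_integral lebesgue (ball (d i) (1 / real (Suc j))) (\<lambda>x. u (\<sigma> a) x - u (\<sigma> b) x)\<bar> \<le> \<delta>"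
        if i: "i < I" for i
      proof -
        have "N i \<le> sum N {..<I}"
          using i by (intro member_le_sum) auto
        then have "\<bar>F (\<sigma> a) (j, i) - F (\<sigma> b) (j, i)\<bar> < \<delta>"
          using ab by (intro N) auto
        then show ?thesis
          using set_integral_diff(2)[OF int int] by (simp add: F_def)
      qed
      then show "weighted_integral r K (\<lambda>x. u (\<sigma> a) x - u (\<sigma> b) x) \<le> ennreal e"
        using small diff by blast
    qed
  qed
  with \<sigma>(1) show ?thesis
    by blast
qed

section \<open>Inclusion, norm bound and injectivity; the compact embedding\<close>

lemma M_space_subset_weighted_Lebesgue: "M_space s q p V \<subseteq> weighted_Lebesgue r K"
proof
  fix u assume "u \<in> M_space s q p V"
  then obtain A where A: "0 < A" "u \<in> bounded_functions A"
    using M_space_bounded_functions by blast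
  then obtain B where "weighted_integral r K u \<le> ennreal B"
    using weighted_integral_bounded by blast
  then have "weighted_integral r K u < \<infinity>"
    by (rule le_less_trans) simp
  then show "u \<in> weighted_Lebesgue r K"
    using bounded_functions_measurable[OF A(2)]
    by (auto simp: weighted_Lebesgue_def weighted_norm_def ennpowr_def)
qed

text \<open>Functions of norm at most 1 have bounded weighted integral; the general case follows by
  rescaling.\<close>

lemma weighted_norm_le_M_norm:
  "\<exists>C::real. \<forall>u\<in>M_space s q p V. weighted_norm r K u \<le> ennreal C * M_norm s q p V u"
proof -
  have r: "1 \<le> r" using q qr by simp
  obtain A where A: "0 < A" and bd: "\<And>w :: real ^ 'n \<Rightarrow> real. M_norm s q p V w \<le> ennreal 1 \<Longrightarrow>
      weighted_integral q V w \<le> ennreal A \<and> M_seminorm_integral s p w \<le> ennreal A"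
    using M_norm_boundD[OF q p zero_less_one] by blast
  obtain B where B: "0 < B" "\<And>w. w \<in> bounded_functions A \<Longrightarrow> weighted_integral r K w \<le> ennreal B"
    using weighted_integral_bounded[OF A] by blast
  define C where "C = B powr (1 / r)"
  have C: "0 < C" using B by (simp add: C_def)
  have BC: "B = C powr (1 / (1 / r))"
    using B r by (simp add: C_def powr_powr)
  have "weighted_norm r K u \<le> ennreal C * M_norm s q p V u" if u: "u \<in> M_space s q p V" for u
  proof (cases "M_norm s q p V u")
    case top
    then show ?thesis using C by (simp add: ennreal_mult_top)
  next
    case (real N)
    have um: "u \<in> borel_measurable lebesgue" using u by (simp add: M_space_def)
    have "weighted_norm r K u \<le> ennreal (C * (N + e))" if e: "0 < e" for e
    proof -
      \<comment> \<open>Dividing by N + e instead of \<open>N\<close> covers norm 0 as well;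
        \<open>e\<close> is removed at the end.\<close>
      define c where "c = 1 / (N + e)"
      have c: "0 < c" using real e by (simp add: c_def)
      have "M_norm s q p V (\<lambda>x. c * u x) \<le> ennreal c * ennreal N"
        using M_norm_scale_le[OF um V Vpos q p c, of s] real by simp
      also have "\<dots> = ennreal (c * N)"
        using c real by (simp add: ennreal_mult)
      also have "\<dots> \<le> ennreal 1"
        using real e by (intro ennreal_leI) (simp add: c_def)
      finally have "(\<lambda>x. c * u x) \<in> bounded_functions A"
        using bd um by (auto simp: bounded_functions_def)
      then have "weighted_integral r K (\<lambda>x. c * u x) \<le> ennreal (C powr (1 / (1 / r)))"
        using B(2) BC by simp
      then have "weighted_norm r K (\<lambda>x. c * u x) \<le> ennreal C"
        unfolding weighted_norm_def using r C by (intro ennpowr_le) auto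
      then have "ennreal c * weighted_norm r K u \<le> ennreal C"
        using weighted_norm_scale[OF um K Kpos _ c, of r] r by simp
      then have "weighted_norm r K u \<le> ennreal (C / c)"
        using c C by (intro le_divide_ennrealI) auto
      then show ?thesis
        by (simp add: c_def)
    qed
    note le = this
    have *: "weighted_norm r K u \<le> ennreal (C * N) + ennreal e" if e: "0 < e" for e
    proof -
      \<comment> \<open>The increment e / C turns into exactly \<open>e\<close> after multiplication
        by \<open>C\<close>.\<close>
      have "weighted_norm r K u \<le> ennreal (C * (N + e / C))"
        using e C by (intro le) simp
      also have "C * (N + e / C) = C * N + e"
        using C by (simp add: distrib_left)
      also have "ennreal (C * N + e) = ennreal (C * N) + ennreal e"
        using C e real by (intro ennreal_plus) auto
      finally show ?thesis .
    qed
    have "weighted_norm r K u \<le> ennreal (C * N)"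
      by (rule ennreal_le_epsilon) (rule *)
    then show ?thesis
      using real C by (simp add: ennreal_mult)
  qed
  then show ?thesis by blast
qed

text \<open>Positivity of \<open>K\<close> gives u = 0 almost everywhere. Integrals depend only on
  the class of \<open>u\<close>, but for p = \<infinity> the seminorm is a supremum over all points,
  where continuity is needed to conclude that \<open>u\<close> vanishes everywhere.\<close>

lemma weighted_norm_zero_imp_M_norm_zero:
  assumes u: "u \<in> M_space s q p V" and zero: "weighted_norm r K u = 0"
  shows "M_norm s q p V u = 0"
proof -
  have um[measurable]: "u \<in> borel_measurable lebesgue"
    using u by (simp add: M_space_def)
  obtain A where A: "0 < A" "u \<in> bounded_functions A"
    using M_space_bounded_functions[OF u] by blast
  have "weighted_integral r K u = 0"
    using zero by (cases "weighted_integral r K u")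
      (auto simp: weighted_norm_def ennpowr_def ennreal_eq_0_iff split: if_splits)
  then have "AE x in lebesgue. ennreal (\<bar>u x\<bar> powr r * K x) = 0"
    unfolding weighted_integral_def by (subst (asm) nn_integral_0_iff_AE) auto
  then have ae: "AE x in lebesgue. u x = 0"
  proof eventually_elim
    case (elim x)
    then have "\<bar>u x\<bar> powr r * K x \<le> 0"
      by (simp add: ennreal_eq_0_iff)
    then show ?case
      using Kpos[of x] by (simp add: mult_le_0_iff)
  qed
  have "weighted_integral q V u = (\<integral>\<^sup>+x. 0 \<partial>(lebesgue :: (real ^ 'n) measure))"
    unfolding weighted_integral_def
    by (rule nn_integral_cong_AE) (use ae in eventually_elim, simp)
  then have "weighted_norm q V u = 0"
    by (simp add: weighted_norm_def ennpowr_def)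
  moreover have "gagliardo_seminorm s p u = 0"
  proof (cases "p = \<infinity>")
    case True
    have "M_seminorm_integral s p u \<le> ennreal A"
      using A by (simp add: bounded_functions_def)
    with True have "holder_seminorm s u \<le> ennreal A"
      by (simp add: M_seminorm_integral_def)
    then have "u x = 0" for x
      using A(1) s ae by (rule holder_AE_zero)
    then have "holder_seminorm s u \<le> ennreal 0"
      by (subst holder_seminorm_le_iff) auto
    with True show ?thesis
      by (simp add: gagliardo_seminorm_def)
  next
    case False
    have "AE x in lborel. u x = 0"
      using ae by (simp add: AE_completion_iff)
    then have "gagliardo_integral s (enn2real p) u = gagliardo_integral s (enn2real p) (\<lambda>_ :: real ^ 'n. 0)"
      by (rule gagliardo_integral_cong_AE)
    then show ?thesis
      using False by (simp add: gagliardo_seminorm_def gagliardo_integral_def ennpowr_def)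
  qed
  ultimately show ?thesis
    by (simp add: M_norm_def)
qed

lemma compact_embedding_M_space:
  "compact_embedding (M_space s q p V) (M_norm s q p V) (weighted_Lebesgue r K) (weighted_norm r K)"
  unfolding compact_embedding_def
proof (intro conjI allI impI ballI)
  fix u :: "nat \<Rightarrow> real ^ 'n \<Rightarrow> real"
  assume *: "(\<forall>k. u k \<in> M_space s q p V) \<and> (\<exists>B::real. \<forall>k. M_norm s q p V (u k) \<le> ennreal B)"
  then obtain B0 :: real where B0: "\<And>k. M_norm s q p V (u k) \<le> ennreal B0"
    by blast
  \<comment> \<open>The given bound need not be positive, whereas \<open>M_norm_boundD\<close> asks
    for a positive one.\<close>
  define B where "B = max B0 1"
  have B: "0 < B" by (simp add: B_def)
  have le: "M_norm s q p V (u k) \<le> ennreal B" for k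
    using B0[of k] by (rule order_trans) (intro ennreal_leI, simp add: B_def)
  obtain A where A: "0 < A" "\<And>w :: real ^ 'n \<Rightarrow> real. M_norm s q p V w \<le> ennreal B \<Longrightarrow>
      weighted_integral q V w \<le> ennreal A \<and> M_seminorm_integral s p w \<le> ennreal A"
    using M_norm_boundD[OF q p B] by blast
  have "u k \<in> bounded_functions A" for k
    using A(2)[OF le] * by (auto simp: bounded_functions_def M_space_def)
  then show "\<exists>\<sigma>. strict_mono \<sigma> \<and> (\<exists>f\<in>weighted_Lebesgue r K.
      (\<lambda>k. weighted_norm r K (\<lambda>x. u (\<sigma> k) x - f x)) \<longlonglongrightarrow> 0)"
    by (rule bounded_functions_convergent_subsequence[OF A(1)])
qed (use M_space_subset_weighted_Lebesgue weighted_norm_le_M_norm weighted_norm_zero_imp_M_norm_zero in blast)+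

end

theorem theorem9:
  fixes K V :: "real ^ 'n \<Rightarrow> real" and p t :: ennreal and s q r V\<^sub>0 :: real
  assumes "CARD('n) \<ge> 2"
    and "1 \<le> p" and "0 < s" and "s < 1" and "ennreal s * p \<ge> of_nat CARD('n)"
    and "1 \<le> q" and "q \<le> r"
    and "K \<in> borel_measurable lebesgue" and "\<And>x. K x > 0"
    and "V \<in> borel_measurable lebesgue" and "\<And>x. V x > 0"
    and "1 < t"
    and "\<And>\<Omega>. \<Omega> \<in> sets lebesgue \<Longrightarrow> emeasure lebesgue \<Omega> < \<infinity> \<Longrightarrow> Lp_on t \<Omega> K"
    and "0 < V\<^sub>0" and "V\<^sub>0 \<le> (INF x. V x)"
    and "q < r \<Longrightarrow> \<exists>\<tau>. 0 < \<tau> \<and> \<tau> < 1 \<and> vanishes_at_infinity (\<lambda>x. K x * V x powr (- \<tau>))"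
    and "q = r \<Longrightarrow> vanishes_at_infinity (\<lambda>x. K x * V x powr (- 1))"
  shows "compact_embedding (M_space s q p V) (M_norm s q p V)
           (weighted_Lebesgue r K) (weighted_norm r K)"
proof -
  have V\<^sub>0_le: "V\<^sub>0 \<le> V x" for x
  proof -
    have "(INF x. V x) \<le> V x"
      \<comment> \<open>The lower bound 0 from positivity of \<open>V\<close> makes the real-valued
        \<open>INF\<close> a genuine infimum.\<close>
      by (rule cINF_lower) (auto intro!: bdd_belowI[of _ 0] less_imp_le assms(11))
    with assms(15) show ?thesis
      by simp
  qed
  obtain T where T: "1 < T" "\<And>\<Omega>. \<Omega> \<in> sets lebesgue \<Longrightarrow> emeasure lebesgue \<Omega> < \<infinity> \<Longrightarrow>
      (\<integral>\<^sup>+x\<in>\<Omega>. ennreal (K x powr T) \<partial>lebesgue) < \<infinity>"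
    using Lp_on_finite_exponent[OF assms(12,9,13)] by blast
  obtain m where m: "q \<le> m" "\<And>e. 0 < e \<Longrightarrow> \<exists>\<Omega>\<in>sets lebesgue. emeasure lebesgue \<Omega> < \<infinity> \<and>
      (\<forall>x z. x \<notin> \<Omega> \<longrightarrow> 0 \<le> z \<longrightarrow> z powr r * K x \<le> e * (z powr q * V x + z powr m))"
    using weight_tail_powr[OF assms(8,10,9,11,6,7,16,17)] by blast
  interpret weight_pair K V p s q r V\<^sub>0 T m
    by unfold_locales (fact assms V\<^sub>0_le T m)+
  show ?thesis
    by (rule compact_embedding_M_space)
qed

end
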